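(* We have $g(p)\ge 2\log_3(p)$ for every prime $p$. Moreover, for every $\varepsilon>0$, there exists a constant $C(\varepsilon)$ such that $g(p)\le (2+\varepsilon)\log_3(p)$ for every prime $p>C(\varepsilon)$.
   Context: For a prime $p$, $\mathbb{F}_p$ denotes the field with $p$ elements, and $\log_3$ denotes the logarithm with base $3$. A nonempty subset $A$ of $\mathbb{F}_p$ has a unique difference if there is $x\in\mathbb{F}_p$ such that there is exactly one ordered pair $(a,b)$, $a,b\in A$, with $x=a-b$. A subset $B$ of $\mathbb{F}_p$ is called symmetric if $B=-B$. For a prime $p$, $g(p)$ denotes the largest number such that every symmetric subset of $\mathbb{F}_p$ with at most $g(p)$ elements has a unique difference.
   Formalization: The lower bound g(p) ≥ 2 log_3(p) is stated for every prime p other than 2; at p = 2 it is false, since F_2 itself is symmetric with two elements and no unique difference, so g(2) = 1 < 2 log_3(2). *)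

theory Defs
  imports Complex_Main "HOL-Number_Theory.Residues"
begin

definition has_unique_difference :: "('a, 'm) ring_scheme \<Rightarrow> 'a set \<Rightarrow> bool" where
  "has_unique_difference R A \<longleftrightarrow>
     (\<exists>x\<in>carrier R. \<exists>!ab. ab \<in> A \<times> A \<and> x = fst ab \<ominus>\<^bsub>R\<^esub> snd ab)"

definition symmetric_subset :: "('a, 'm) ring_scheme \<Rightarrow> 'a set \<Rightarrow> bool" where
  "symmetric_subset R B \<longleftrightarrow> B \<subseteq> carrier R \<and> B = (\<lambda>b. \<ominus>\<^bsub>R\<^esub> b) ` B"

text \<open>
  The field with \<open>p\<close> elements is \<open>residue_ring (int p)\<close>, with carrier \<open>{0..int p - 1}\<close>.
  The empty set has no unique difference, so only nonempty sets are considered.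
  For prime \<open>p\<close> the maximum exists: see \<open>le_g_iff\<close>.
\<close>

definition g :: "nat \<Rightarrow> nat" where
  "g p = (GREATEST n. \<forall>B. symmetric_subset (residue_ring (int p)) B \<and> B \<noteq> {} \<and> card B \<le> n
            \<longrightarrow> has_unique_difference (residue_ring (int p)) B)"

lemma carrier_not_unique_difference:
  assumes p: "prime p"
  shows "symmetric_subset (residue_ring (int p)) (carrier (residue_ring (int p)))"
    and "\<not> has_unique_difference (residue_ring (int p)) (carrier (residue_ring (int p)))"
proof -
  define R where "R = residue_ring (int p)"
  interpret residues_prime p R using p by unfold_locales (auto simp: R_def)
  have "carrier R = (\<lambda>b. \<ominus>\<^bsub>R\<^esub> b) ` carrier R"
  proof
    show "carrier R \<subseteq> (\<lambda>b. \<ominus>\<^bsub>R\<^esub> b) ` carrier R"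
      by (metis a_inv_closed image_eqI minus_minus subsetI)
  qed auto
  then show "symmetric_subset (residue_ring (int p)) (carrier (residue_ring (int p)))"
    by (simp add: symmetric_subset_def R_def)
  have "\<not> has_unique_difference R (carrier R)"
  proof
    assume "has_unique_difference R (carrier R)"
    then obtain x y where y: "y \<in> carrier R \<times> carrier R" "x = fst y \<ominus>\<^bsub>R\<^esub> snd y"
      and u: "\<And>z. z \<in> carrier R \<times> carrier R \<and> x = fst z \<ominus>\<^bsub>R\<^esub> snd z \<Longrightarrow> z = y"
      unfolding has_unique_difference_def by (elim bexE ex1E conjE) blast
    obtain a b where "y = (a, b)" by (cases y)
    with y have ab: "a \<in> carrier R" "b \<in> carrier R" "x = a \<ominus>\<^bsub>R\<^esub> b" by auto
    let ?c = "a \<oplus>\<^bsub>R\<^esub> \<one>\<^bsub>R\<^esub>" and ?d = "b \<oplus>\<^bsub>R\<^esub> \<one>\<^bsub>R\<^esub>"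
    have "?c \<ominus>\<^bsub>R\<^esub> ?d = x \<oplus>\<^bsub>R\<^esub> (\<one>\<^bsub>R\<^esub> \<ominus>\<^bsub>R\<^esub> \<one>\<^bsub>R\<^esub>)"
      using ab by (simp add: minus_eq minus_add a_ac)
    also have "\<dots> = x"
      using ab by (simp add: r_neg minus_eq)
    finally have "?c = a" using u[of "(?c, ?d)"] ab \<open>y = (a, b)\<close> by simp
    then show False using ab(1) one_not_zero by simp
  qed
  then show "\<not> has_unique_difference (residue_ring (int p)) (carrier (residue_ring (int p)))"
    by (simp add: R_def)
qed

lemma singleton_unique_difference:
  assumes p: "prime p" and b: "b \<in> carrier (residue_ring (int p))"
  shows "has_unique_difference (residue_ring (int p)) {b}"
proof -
  define R where "R = residue_ring (int p)"
  interpret residues_prime p R using p by unfold_locales (auto simp: R_def)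
  have b: "b \<in> carrier R" using b by (simp add: R_def)
  then have "b \<ominus>\<^bsub>R\<^esub> b \<in> carrier R" by simp
  moreover have "\<exists>!ab. ab \<in> {b} \<times> {b} \<and> b \<ominus>\<^bsub>R\<^esub> b = fst ab \<ominus>\<^bsub>R\<^esub> snd ab"
    by (rule ex1I[of _ "(b, b)"]) (simp, blast)
  ultimately have "has_unique_difference R {b}"
    unfolding has_unique_difference_def by (rule bexI[rotated])
  then show ?thesis by (simp add: R_def)
qed

lemma le_g_iff:
  assumes p: "prime p"
  shows "n \<le> g p \<longleftrightarrow>
    (\<forall>B. symmetric_subset (residue_ring (int p)) B \<and> B \<noteq> {} \<and> card B \<le> n
       \<longrightarrow> has_unique_difference (residue_ring (int p)) B)" (is "_ \<longleftrightarrow> ?P n")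
proof -
  have card: "card (carrier (residue_ring (int p))) = p"
    by (simp add: residue_ring_def)
  have ne: "carrier (residue_ring (int p)) \<noteq> {}"
    using prime_gt_0_nat[OF p] by (auto simp: residue_ring_def)
  have bound: "m \<le> p" if "?P m" for m
    using that carrier_not_unique_difference[OF p] card ne by (metis nat_le_linear)
  have zero: "?P 0"
  proof (intro allI impI, elim conjE)
    fix B assume B: "symmetric_subset (residue_ring (int p)) B" "B \<noteq> {}" "card B \<le> 0"
    then have "finite B"
      by (auto simp: symmetric_subset_def residue_ring_def intro: finite_subset)
    with B show "has_unique_difference (residue_ring (int p)) B" by simp
  qed
  have "?P (g p)"
    unfolding g_def by (rule GreatestI_nat[of ?P 0 p]) (use zero bound in blast)+
  moreover have "m \<le> g p" if "?P m" for m
    unfolding g_def by (rule Greatest_le_nat[of ?P m p]) (use that bound in blast)+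
  ultimately show ?thesis by (meson order_trans)
qed

text \<open>
  In characteristic 2 every set is symmetric, and \<open>2 * log 3 2 > 1\<close>, so the following shows
  that the inequality \<open>g p \<ge> 2 * log 3 p\<close> fails at the prime 2.
\<close>

lemma g_2: "g 2 = 1"
proof -
  have "1 \<le> g 2"
    unfolding le_g_iff[OF two_is_prime_nat]
  proof (intro allI impI, elim conjE)
    fix B :: "int set"
    assume B: "symmetric_subset (residue_ring (int 2)) B" "B \<noteq> {}" "card B \<le> 1"
    have sub: "B \<subseteq> carrier (residue_ring (int 2))"
      using B(1) by (simp add: symmetric_subset_def)
    then have "finite B" by (rule finite_subset) (simp add: residue_ring_def)
    with B obtain b where b: "B = {b}"
      by (metis One_nat_def card_0_eq card_1_singletonE le_Suc_eq le_zero_eq)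
    then show "has_unique_difference (residue_ring (int 2)) B"
      using sub singleton_unique_difference[OF two_is_prime_nat] by simp
  qed
  moreover have "\<not> 2 \<le> g 2"
  proof -
    let ?F = "carrier (residue_ring (int 2))"
    have "?F \<noteq> {}" "card ?F \<le> 2" by (simp_all add: residue_ring_def)
    then show ?thesis
      unfolding le_g_iff[OF two_is_prime_nat]
      using carrier_not_unique_difference[OF two_is_prime_nat] by blast
  qed
  ultimately show ?thesis by linarith
qed

lemma lower_bound_fails_at_2: "real (g 2) < 2 * log 3 (real 2)"
proof -
  have "1 < log 3 (4::real)" by simp
  also have "log 3 (4::real) = 2 * log 3 2"
    using log_nat_power[of "2::real" 3 2] by simp
  finally show ?thesis by (simp add: g_2)
qed

end

theory Submission
  imports Defs "Jordan_Normal_Form.Determinant"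
begin

text \<open>
  A difference \<open>a - b\<close> of elements of a symmetric set also arises from the pair \<open>(-b, -a)\<close>. Hence, for
  odd \<open>p\<close>, a symmetric set \<open>A\<close> has no unique difference iff it is midpoint closed: every \<open>a \<in> A\<close>
  satisfies \<open>2a = b + c\<close> with \<open>b, c \<in> A\<close> different from \<open>a\<close>.

  Lower bound. Choose one equation \<open>2a = b + c\<close> for each pair \<open>{a, -a}\<close>, preferring \<open>2a = 3a + (-a)\<close>
  whenever \<open>3a \<in> A\<close>. The resulting integer system has the solution \<open>x\<^sub>a = a\<close> modulo \<open>p\<close>, so \<open>p\<close>
  divides its determinant. If the real system has a nontrivial odd solution, the set where it is
  maximal is midpoint closed and disjoint from its negative, and the same argument, applied to a
  minimal midpoint-closed set, bounds \<open>p\<close> even better. Otherwise the determinant is nonzero. The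
  equations \<open>x\<^bsub>3a\<^esub> = 3x\<^sub>a\<close> are eliminated along chains \<open>a, 3a, 9a, \<dots>\<close>; after rescaling the columns
  the remaining rows have squared norm at most 8, and Hadamard's inequality bounds the determinant by
  \<open>3\<^sup>k\<close>, where \<open>k\<close> is the number of pairs. If \<open>0 \<notin> A\<close> every row sum is even, so the determinant is
  even as well, which supplies the missing factor \<open>\<surd>3\<close>.

  Upper bound. Write a multiple of \<open>p\<close> in base \<open>q = 2 \<cdot> 3\<^sup>s\<close> with leading digit \<open>q - 1\<close>, and collect the
  values of Horner's scheme, with each multiplication by \<open>q\<close> carried out by \<open>s\<close> multiplications by 3
  and one step \<open>x \<mapsto> 2x + d\<close>. Together with the integers of absolute value below \<open>q\<close> and all
  negatives this is midpoint closed modulo \<open>p\<close>, and it has about \<open>2 (1 + 1/s) log\<^sub>3 p\<close> elements.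
\<close>

subsection \<open>Hadamard's inequality and prime divisors of determinants\<close>

definition row_ip :: "real mat \<Rightarrow> nat \<Rightarrow> nat \<Rightarrow> real" where
  "row_ip A i j = (\<Sum>c<dim_col A. A $$ (i, c) * A $$ (j, c))"

lemma row_ip_commute: "row_ip A i j = row_ip A j i"
  by (simp add: row_ip_def mult.commute)

lemma row_ip_self_nonneg: "0 \<le> row_ip A i i"
  by (simp add: row_ip_def sum_nonneg)

lemma row_ip_self_eq_0:
  assumes "row_ip A l l = 0"
  shows "row_ip A i l = 0"
proof -
  have "\<forall>c\<in>{..<dim_col A}. A $$ (l, c) * A $$ (l, c) = 0"
    using assms unfolding row_ip_def by (subst (asm) sum_nonneg_eq_0_iff) auto
  then show ?thesis by (simp add: row_ip_def)
qed

lemma row_ip_addrow: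
  assumes "k < dim_row A" "i < dim_row A" "j < dim_row A"
  shows "row_ip (addrow a k l A) i j = row_ip A i j
    + (if i = k then a * row_ip A l j else 0) + (if j = k then a * row_ip A i l else 0)
    + (if i = k \<and> j = k then a\<^sup>2 * row_ip A l l else 0)"
  using assms
  by (auto simp: row_ip_def sum.distrib[symmetric] sum_distrib_left algebra_simps power2_eq_square
      intro!: sum.cong)

text \<open>Gram-Schmidt on row \<open>k\<close> by adding multiples of earlier rows: the
  determinant is kept, and removing a projection can only shorten the row. Nothing is normalized; an
  earlier row of norm 0 is already orthogonal to everything.\<close>

lemma orthogonalize_row:
  assumes A: "A \<in> carrier_mat n n" and k: "k < n" and lk: "l \<le> k"
    and orth: "\<And>i j. i < k \<Longrightarrow> j < i \<Longrightarrow> row_ip A i j = 0"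
  shows "\<exists>B \<in> carrier_mat n n. det B = det A \<and> (\<forall>i<n. row_ip B i i \<le> row_ip A i i)
     \<and> (\<forall>i<k. \<forall>j<i. row_ip B i j = 0) \<and> (\<forall>j<l. row_ip B k j = 0)"
  using lk
proof (induction l)
  case 0
  then show ?case using A orth by (intro bexI[of _ A]) auto
next
  case (Suc l)
  then obtain B where B: "B \<in> carrier_mat n n" "det B = det A"
    and le: "\<And>i. i < n \<Longrightarrow> row_ip B i i \<le> row_ip A i i"
    and o1: "\<And>i j. i < k \<Longrightarrow> j < i \<Longrightarrow> row_ip B i j = 0"
    and o2: "\<And>j. j < l \<Longrightarrow> row_ip B k j = 0" by auto
  have l: "l < k" using Suc.prems by simp
  have ln: "l < n" using l k by simp
  show ?case
  proof (cases "row_ip B l l = 0")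
    case True
    then have "row_ip B k l = 0" by (rule row_ip_self_eq_0)
    then show ?thesis using B le o1 o2 by (intro bexI[of _ B]) (auto simp: less_Suc_eq)
  next
    case False
    then have pos: "row_ip B l l > 0" using row_ip_self_nonneg[of B l] by linarith
    define a where "a = - row_ip B k l / row_ip B l l"
    define C where "C = addrow a k l B"
    have ip: "row_ip C i j = row_ip B i j
      + (if i = k then a * row_ip B l j else 0) + (if j = k then a * row_ip B i l else 0)
      + (if i = k \<and> j = k then a\<^sup>2 * row_ip B l l else 0)" if "i < n" "j < n" for i j
      unfolding C_def using that k B(1) by (intro row_ip_addrow) auto
    have "C \<in> carrier_mat n n" using B(1) by (simp add: C_def)
    moreover have "det C = det A"
      unfolding C_def using det_addrow[OF ln _ B(1)] l B(2) by auto
    moreover have "row_ip C i i \<le> row_ip A i i" if "i < n" for i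
    proof (cases "i = k")
      case True
      have "row_ip C k k = row_ip B k k + 2 * (a * row_ip B k l) + a\<^sup>2 * row_ip B l l"
        using ip[OF k k] row_ip_commute[of B l k] by simp
      also have "\<dots> = row_ip B k k - (row_ip B k l)\<^sup>2 / row_ip B l l"
        using pos by (simp add: a_def power2_eq_square field_simps)
      also have "\<dots> \<le> row_ip B k k" using pos by simp
      finally show ?thesis using le[OF k] True by simp
    next
      case False
      then show ?thesis using ip[OF that that] le[OF that] by simp
    qed
    moreover have "row_ip C i j = 0" if "i < k" "j < i" for i j
      using ip[of i j] o1[OF that] that k by simp
    moreover have "row_ip C k j = 0" if "j < Suc l" for j
    proof -
      have jk: "j < k" "j < n" using that l k by auto
      have "row_ip C k j = row_ip B k j + a * row_ip B l j"
        using ip[OF k jk(2)] jk by simp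
      also have "\<dots> = 0"
      proof (cases "j = l")
        case True
        then show ?thesis using pos by (simp add: a_def)
      next
        case False
        then show ?thesis using that o2[of j] o1[OF l, of j] by simp
      qed
      finally show ?thesis .
    qed
    ultimately show ?thesis by (intro bexI[of _ C]) auto
  qed
qed

lemma orthogonalize:
  assumes A: "A \<in> carrier_mat n n" and k: "k \<le> n"
  shows "\<exists>B \<in> carrier_mat n n. det B = det A \<and> (\<forall>i<n. row_ip B i i \<le> row_ip A i i)
     \<and> (\<forall>i<k. \<forall>j<i. row_ip B i j = 0)"
  using k
proof (induction k)
  case 0
  then show ?case using A by (intro bexI[of _ A]) auto
next
  case (Suc k)
  then obtain B where B: "B \<in> carrier_mat n n" "det B = det A"
    and le: "\<And>i. i < n \<Longrightarrow> row_ip B i i \<le> row_ip A i i"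
    and o1: "\<And>i j. i < k \<Longrightarrow> j < i \<Longrightarrow> row_ip B i j = 0" by auto
  from orthogonalize_row[OF B(1) _ order_refl o1] Suc.prems
  obtain C where C: "C \<in> carrier_mat n n" "det C = det B"
    "\<And>i. i < n \<Longrightarrow> row_ip C i i \<le> row_ip B i i"
    "\<And>i j. i < k \<Longrightarrow> j < i \<Longrightarrow> row_ip C i j = 0" "\<And>j. j < k \<Longrightarrow> row_ip C k j = 0"
    by (metis Suc_le_lessD)
  then show ?case using le B by (intro bexI[of _ C]) (force simp: less_Suc_eq intro: order_trans)+
qed

text \<open>Orthogonalizing keeps the determinant and lengthens no row, and the Gram matrix of
  orthogonal rows is triangular with the squared norms on its diagonal.\<close>

theorem hadamard_inequality:
  assumes A: "A \<in> carrier_mat n n"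
  shows "(det A)\<^sup>2 \<le> (\<Prod>i<n. row_ip A i i)"
proof -
  obtain B where B: "B \<in> carrier_mat n n" "det B = det A"
    and le: "\<And>i. i < n \<Longrightarrow> row_ip B i i \<le> row_ip A i i"
    and o: "\<And>i j. i < n \<Longrightarrow> j < i \<Longrightarrow> row_ip B i j = 0"
    using orthogonalize[OF A order_refl] by auto
  define G where "G = B * transpose_mat B"
  have G: "G \<in> carrier_mat n n" using B(1) by (simp add: G_def)
  have ent: "G $$ (i, j) = row_ip B i j" if "i < n" "j < n" for i j
    using B(1) that by (simp add: G_def row_ip_def scalar_prod_def lessThan_atLeast0)
  have "upper_triangular G"
    using G ent o by (intro upper_triangularI) auto
  then have "det G = (\<Prod>i<n. row_ip B i i)"
    using det_upper_triangular[OF _ G] G ent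
    by (simp add: prod_list_diag_prod lessThan_atLeast0)
  moreover have "det G = (det B)\<^sup>2"
    using det_mult[OF B(1), of "transpose_mat B"] B(1) det_transpose[OF B(1)]
    by (simp add: G_def power2_eq_square)
  ultimately have "(det A)\<^sup>2 = (\<Prod>i<n. row_ip B i i)" using B(2) by simp
  also have "\<dots> \<le> (\<Prod>i<n. row_ip A i i)"
    using le row_ip_self_nonneg by (intro prod_mono) auto
  finally show ?thesis .
qed

text \<open>A solution modulo a prime that is not zero modulo it forces the prime to divide the
  determinant, and a trivial real kernel makes the determinant nonzero; so its absolute value is at
  least the product of the primes. The weights \<open>w\<close> divide the columns before Hadamard's
  inequality is applied and are paid back as a product. A set of primes is allowed so that 2 can
  join the prime of interest.\<close>

lemma prod_primes_le_det_bound: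
  fixes c :: "'a \<Rightarrow> 'a \<Rightarrow> int" and w :: "'a \<Rightarrow> real" and P :: "int set"
  assumes fin: "finite I" and P: "finite P" "\<And>p. p \<in> P \<Longrightarrow> prime p"
    and sol: "\<And>p. p \<in> P \<Longrightarrow> \<exists>v. (\<forall>i\<in>I. p dvd (\<Sum>j\<in>I. c i j * v j)) \<and> (\<exists>i\<in>I. \<not> p dvd v i)"
    and ker: "\<And>x :: 'a \<Rightarrow> real. (\<And>i. i \<in> I \<Longrightarrow> (\<Sum>j\<in>I. of_int (c i j) * x j) = 0)
       \<Longrightarrow> (\<And>i. i \<in> I \<Longrightarrow> x i = 0)"
    and w: "\<And>j. j \<in> I \<Longrightarrow> w j > 0"
    and bd: "\<And>i. i \<in> I \<Longrightarrow> (\<Sum>j\<in>I. (of_int (c i j) / w j)\<^sup>2) \<le> N"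
  shows "(of_int (\<Prod>P))\<^sup>2 \<le> N ^ card I * (\<Prod>j\<in>I. (w j)\<^sup>2)"
proof -
  define n where "n = card I"
  obtain e where e: "bij_betw e {..<n} I"
    using ex_bij_betw_nat_finite[OF fin] by (auto simp: n_def lessThan_atLeast0)
  have eI: "e i \<in> I" if "i < n" for i using e that by (auto simp: bij_betw_def)
  have reidx: "(\<Sum>j<n. f (e j)) = sum f I" for f :: "'a \<Rightarrow> 'b::comm_monoid_add"
    by (rule sum.reindex_bij_betw[OF e])
  define Ai where "Ai = mat n n (\<lambda>(i, j). c (e i) (e j))"
  define Ar :: "real mat" where "Ar = map_mat of_int Ai"
  have Ai: "Ai \<in> carrier_mat n n" by (simp add: Ai_def)
  have Ar: "Ar \<in> carrier_mat n n" using Ai by (simp add: Ar_def)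
  have detAr: "det Ar = of_int (det Ai)" by (simp add: Ar_def)
  have "det Ar \<noteq> 0"
  proof
    assume "det Ar = 0"
    then obtain x where x: "x \<in> carrier_vec n" "x \<noteq> 0\<^sub>v n" "Ar *\<^sub>v x = 0\<^sub>v n"
      using det_0_iff_vec_prod_zero_field[OF Ar] by auto
    define y where "y a = x $ (inv_into {..<n} e a)" for a
    have y: "y (e j) = x $ j" if "j < n" for j
      using that e by (simp add: y_def bij_betw_def inv_into_f_f)
    have "(\<Sum>j\<in>I. of_int (c i j) * y j) = 0" if "i \<in> I" for i
    proof -
      obtain k where k: "k < n" "i = e k" using e \<open>i \<in> I\<close> unfolding bij_betw_def by auto
      have "(\<Sum>j\<in>I. of_int (c i j) * y j) = (\<Sum>j<n. of_int (c i (e j)) * y (e j))"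
        by (rule reidx[symmetric])
      also have "\<dots> = (Ar *\<^sub>v x) $ k"
        using k x(1) by (simp add: Ar_def Ai_def scalar_prod_def lessThan_atLeast0 y)
      finally show ?thesis using x(3) k by simp
    qed
    then have "y i = 0" if "i \<in> I" for i using ker that by blast
    then have "x $ j = 0" if "j < n" for j using y[OF that] eI[OF that] by simp
    then have "x = 0\<^sub>v n" using x(1) by (intro eq_vecI) auto
    then show False using x(2) by simp
  qed
  then have det0: "det Ai \<noteq> 0" using detAr by simp
  have pd: "p dvd det Ai" if pP: "p \<in> P" for p
  proof -
    obtain v i0 where v: "\<And>i. i \<in> I \<Longrightarrow> p dvd (\<Sum>j\<in>I. c i j * v j)"
      and nz: "i0 \<in> I" "\<not> p dvd v i0" using sol[OF pP] by blast
    define u where "u = vec n (\<lambda>j. v (e j))"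
    have u: "u \<in> carrier_vec n" by (simp add: u_def)
    have d: "p dvd (Ai *\<^sub>v u) $ k" if "k < n" for k
    proof -
      have "(Ai *\<^sub>v u) $ k = (\<Sum>j<n. c (e k) (e j) * v (e j))"
        using that by (simp add: Ai_def u_def scalar_prod_def lessThan_atLeast0)
      also have "\<dots> = (\<Sum>j\<in>I. c (e k) j * v j)" by (rule reidx)
      finally show ?thesis using v eI[OF that] by simp
    qed
    obtain k where k: "k < n" "i0 = e k" using e nz(1) unfolding bij_betw_def by auto
    note adj = adj_mat[OF Ai]
    have "(det Ai \<cdot>\<^sub>m 1\<^sub>m n) *\<^sub>v u = det Ai \<cdot>\<^sub>v u"
      using u by (intro eq_vecI) (auto simp: scalar_prod_left_unit)
    \<comment> \<open>The adjugate turns divisibility of all entries of the matrix times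
      \<open>u\<close> into divisibility of \<open>det Ai * v i0\<close>.\<close>
    then have "adj_mat Ai *\<^sub>v (Ai *\<^sub>v u) = det Ai \<cdot>\<^sub>v u"
      using assoc_mult_mat_vec[OF adj(1) Ai u] adj(3) u by simp
    then have "det Ai * v i0 = (adj_mat Ai *\<^sub>v (Ai *\<^sub>v u)) $ k"
      using k by (simp add: u_def)
    also have "\<dots> = (\<Sum>j<n. adj_mat Ai $$ (k, j) * (Ai *\<^sub>v u) $ j)"
      using k adj(1) Ai by (simp add: scalar_prod_def lessThan_atLeast0)
    also have "p dvd \<dots>" using d by (intro dvd_sum) auto
    finally show ?thesis using P(2)[OF pP] nz(2) by (simp add: prime_dvd_mult_iff)
  qed
  have "\<Prod>Q dvd det Ai" if "Q \<subseteq> P" for Q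
    using finite_subset[OF that P(1)] that
  proof (induction Q)
    case (insert q Q)
    have "coprime q (\<Prod>Q)"
      using insert P(2) by (intro prod_coprime_right) (auto intro!: primes_coprime)
    then show ?case using insert pd by (simp add: divides_mult)
  qed simp
  then have "\<Prod>P dvd det Ai" by blast
  then have "\<bar>\<Prod>P\<bar> \<le> \<bar>det Ai\<bar>" using det0 by (simp add: dvd_imp_le_int)
  then have "\<bar>of_int (\<Prod>P)\<bar> \<le> \<bar>det Ar\<bar>" unfolding detAr by linarith
  then have "(of_int (\<Prod>P))\<^sup>2 \<le> (det Ar)\<^sup>2" by (simp add: abs_le_square_iff)
  also have "(det Ar)\<^sup>2 \<le> N ^ n * (\<Prod>j\<in>I. (w j)\<^sup>2)"
  proof -
    \<comment> \<open>\<open>S\<close> is the matrix with its columns divided by the weights; the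
      diagonal matrix \<open>W\<close> restores them.\<close>
    define S where "S = mat n n (\<lambda>(i, j). of_int (c (e i) (e j)) / w (e j))"
    define W where "W = mat n n (\<lambda>(i, j). if i = j then w (e j) else 0)"
    have S: "S \<in> carrier_mat n n" and W: "W \<in> carrier_mat n n" by (simp_all add: S_def W_def)
    have "Ar = S * W"
    proof (rule eq_matI)
      fix i j assume "i < dim_row (S * W)" "j < dim_col (S * W)"
      then have ij: "i < n" "j < n" using S W by auto
      have "(S * W) $$ (i, j)
          = (\<Sum>k<n. (of_int (c (e i) (e k)) / w (e k)) * (if k = j then w (e j) else 0))"
        using ij by (simp add: S_def W_def scalar_prod_def lessThan_atLeast0)
      also have "\<dots> = of_int (c (e i) (e j))"
        using ij w[OF eI[OF ij(2)]] by (simp add: if_distrib sum.delta cong: if_cong)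
      finally show "Ar $$ (i, j) = (S * W) $$ (i, j)" using ij by (simp add: Ar_def Ai_def)
    qed (use S W Ar in auto)
    then have "det Ar = det S * det W" using det_mult[OF S W] by simp
    moreover have "det W = (\<Prod>j<n. w (e j))"
    proof -
      have "upper_triangular W" using W by (intro upper_triangularI) (auto simp: W_def)
      then show ?thesis using det_upper_triangular[OF _ W] W
        by (simp add: prod_list_diag_prod W_def lessThan_atLeast0)
    qed
    moreover have "(\<Prod>j<n. w (e j)) = (\<Prod>j\<in>I. w j)" by (rule prod.reindex_bij_betw[OF e])
    ultimately have "(det Ar)\<^sup>2 = (det S)\<^sup>2 * (\<Prod>j\<in>I. (w j)\<^sup>2)"
      by (simp add: power_mult_distrib prod_power_distrib)
    also have "(det S)\<^sup>2 \<le> (\<Prod>i<n. row_ip S i i)" by (rule hadamard_inequality[OF S])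
    also have "\<dots> \<le> (\<Prod>i<n. N)"
    proof (intro prod_mono conjI row_ip_self_nonneg)
      fix i assume "i \<in> {..<n}"
      then have i: "i < n" by simp
      have "row_ip S i i = (\<Sum>j<n. (of_int (c (e i) (e j)) / w (e j))\<^sup>2)"
        using i by (simp add: row_ip_def S_def power2_eq_square)
      also have "\<dots> = (\<Sum>j\<in>I. (of_int (c (e i) j) / w j)\<^sup>2)" by (rule reidx)
      finally show "row_ip S i i \<le> N" using bd eI[OF i] by simp
    qed
    finally show ?thesis by (simp add: mult_right_mono prod_nonneg)
  qed
  finally show ?thesis by (simp add: n_def)
qed

subsection \<open>Midpoint-closed sets of residues\<close>

text \<open>Only \<open>b\<close> is required to differ from \<open>a\<close>: then \<open>c\<close>
  differs from \<open>a\<close> as well, and for an odd prime \<open>b\<close> differs from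
  \<open>c\<close>. Integers with congruences are used so that representatives can be chosen
  freely.\<close>

definition midpoint_closed :: "int \<Rightarrow> int set \<Rightarrow> bool" where
  "midpoint_closed p S \<longleftrightarrow>
     (\<forall>a\<in>S. \<exists>b\<in>S. \<exists>c\<in>S. \<not> [b = a] (mod p) \<and> [b + c = 2 * a] (mod p))"

definition separated :: "int \<Rightarrow> int set \<Rightarrow> bool" where
  "separated p S \<longleftrightarrow> (\<forall>x\<in>S. \<forall>y\<in>S. [x = y] (mod p) \<longrightarrow> x = y)"

lemma separatedD: "separated p S \<Longrightarrow> x \<in> S \<Longrightarrow> y \<in> S \<Longrightarrow> [x = y] (mod p) \<Longrightarrow> x = y"
  by (auto simp: separated_def)

lemma separated_subset: "separated p S \<Longrightarrow> T \<subseteq> S \<Longrightarrow> separated p T"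
  by (auto simp: separated_def)

text \<open>Fixes one equation per element. Distinct indices matter for the row norms, where the
  coefficients 2, -1, -1 must fall into different columns. Equality of \<open>f a\<close> and
  \<open>g a\<close> would make \<open>p\<close> divide \<open>2 * (f a - a)\<close>, which an odd
  prime rules out.\<close>

lemma midpoints:
  fixes p :: int
  assumes p: "prime p" "p \<noteq> 2" and S: "midpoint_closed p S" "separated p S"
  obtains f g where "\<And>a. a \<in> S \<Longrightarrow> f a \<in> S \<and> g a \<in> S \<and> f a \<noteq> a \<and> g a \<noteq> a \<and> f a \<noteq> g a
    \<and> [f a + g a = 2 * a] (mod p)"
proof -
  have "\<exists>bc. fst bc \<in> S \<and> snd bc \<in> S \<and> fst bc \<noteq> a \<and> snd bc \<noteq> a \<and> fst bc \<noteq> snd bc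
    \<and> [fst bc + snd bc = 2 * a] (mod p)" if a: "a \<in> S" for a
  proof -
    obtain b c where bc: "b \<in> S" "c \<in> S" "\<not> [b = a] (mod p)" "[b + c = 2 * a] (mod p)"
      using S(1) a unfolding midpoint_closed_def by blast
    have d: "p dvd b + c - 2 * a" using bc(4) by (simp add: cong_iff_dvd_diff)
    have "c \<noteq> a"
      using d bc(3) by (auto simp: cong_iff_dvd_diff algebra_simps)
    moreover have "b \<noteq> c"
    proof
      assume "b = c"
      then have "p dvd 2 * (b - a)" using d by simp
      moreover have "\<not> p dvd 2" using p prime_ge_2_int[of p] zdvd_imp_le[of p 2] by auto
      ultimately have "p dvd b - a" using p(1) prime_dvd_multD by blast
      then show False using bc(3) by (simp add: cong_iff_dvd_diff)
    qed
    ultimately show ?thesis using bc by (intro exI[of _ "(b, c)"]) auto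
  qed
  then obtain F where F: "\<And>a. a \<in> S \<Longrightarrow> fst (F a) \<in> S \<and> snd (F a) \<in> S \<and> fst (F a) \<noteq> a \<and> snd (F a) \<noteq> a
     \<and> fst (F a) \<noteq> snd (F a) \<and> [fst (F a) + snd (F a) = 2 * a] (mod p)"
    by metis
  show ?thesis by (rule that[of "\<lambda>a. fst (F a)" "\<lambda>a. snd (F a)"]) (use F in auto)
qed

text \<open>Maximum principle: two values whose average is the maximum cannot lie below it.\<close>

lemma Max_level_set_closed:
  fixes x :: "int \<Rightarrow> real"
  assumes "finite S" "a \<in> S" "x a = Max (x ` S)" "b \<in> S" "c \<in> S" "2 * x a = x b + x c"
  shows "x b = Max (x ` S)" "x c = Max (x ` S)"
proof -
  have "x b \<le> Max (x ` S)" "x c \<le> Max (x ` S)" using assms by auto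
  then show "x b = Max (x ` S)" "x c = Max (x ` S)" using assms(3,6) by linarith+
qed

text \<open>By induction \<open>S\<close> may be taken minimal. The equations
  \<open>2 * x a = x (f a) + x (g a)\<close> are invariant under translation, so the row and column
  of one element \<open>s\<close> are deleted. A nontrivial real solution would have a level set
  that is a smaller midpoint-closed set, and every row has squared norm at most 4 + 1 + 1.\<close>

lemma midpoint_closed_card:
  fixes p :: int
  assumes p: "prime p" "p \<noteq> 2" and fin: "finite S" and ne: "S \<noteq> {}"
    and S: "midpoint_closed p S" "separated p S"
  shows "p\<^sup>2 \<le> 6 ^ (card S - 1)"
  using fin ne S
proof (induction "card S" arbitrary: S rule: less_induct)
  case less
  note fin = \<open>finite S\<close>
  show ?case
  proof (cases "\<exists>T. T \<subset> S \<and> T \<noteq> {} \<and> midpoint_closed p T")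
    case True
    then obtain T where T: "T \<subset> S" "T \<noteq> {}" "midpoint_closed p T" by blast
    have c: "card T < card S" using T(1) fin by (rule psubset_card_mono[rotated])
    have "p\<^sup>2 \<le> 6 ^ (card T - 1)"
      using T less.prems c separated_subset[of p S T] finite_subset[of T S]
      by (intro less.hyps) auto
    also have "\<dots> \<le> 6 ^ (card S - 1)" using c by (intro power_increasing) auto
    finally show ?thesis .
  next
    case False
    obtain f g where fg: "\<And>a. a \<in> S \<Longrightarrow> f a \<in> S \<and> g a \<in> S \<and> f a \<noteq> a \<and> g a \<noteq> a \<and> f a \<noteq> g a
      \<and> [f a + g a = 2 * a] (mod p)"
      using midpoints[OF p less.prems(3,4)] by metis
    obtain s where s: "s \<in> S" using less.prems by blast
    define I where "I = S - {s}"
    define c :: "int \<Rightarrow> int \<Rightarrow> int"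
      where "c i j = 2 * of_bool (j = i) - of_bool (j = f i) - of_bool (j = g i)" for i j
    have finI: "finite I" using fin by (simp add: I_def)
    have csum: "(\<Sum>j\<in>S. of_int (c i j) * x j) = 2 * x i - x (f i) - x (g i)"
      if "i \<in> S" for i and x :: "int \<Rightarrow> 'b::comm_ring_1"
    proof -
      have "(\<Sum>j\<in>S. of_int (c i j) * x j) = (\<Sum>j\<in>S. 2 * (if j = i then x j else 0)
         - (if j = f i then x j else 0) - (if j = g i then x j else 0))"
        by (intro sum.cong) (auto simp: c_def)
      also have "\<dots> = 2 * x i - x (f i) - x (g i)"
        using fg[OF that] that fin by (simp add: sum_subtractf sum_distrib_left[symmetric] sum.delta)
      finally show ?thesis .
    qed
    have cI: "(\<Sum>j\<in>I. of_int (c i j) * x j) = (\<Sum>j\<in>S. of_int (c i j) * x j)"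
      if "x s = 0" for i and x :: "int \<Rightarrow> 'b::comm_ring_1"
      unfolding I_def using fin s that by (subst sum.remove[OF fin s]) auto
    have "(of_int (\<Prod>{p}))\<^sup>2 \<le> (6::real) ^ card I * (\<Prod>j\<in>I. (1::real)\<^sup>2)"
    proof (rule prod_primes_le_det_bound[where c = c])
      fix q assume "q \<in> {p}"
      then have [simp]: "q = p" by simp
      \<comment> \<open>The elements themselves solve the system modulo \<open>p\<close>;
        translating by \<open>s\<close> makes this solution vanish at the deleted index.\<close>
      have 1: "p dvd (\<Sum>j\<in>I. c i j * (j - s))" if "i \<in> I" for i
      proof -
        have i: "i \<in> S" using that by (simp add: I_def)
        have "(\<Sum>j\<in>I. c i j * (j - s)) = 2 * i - f i - g i"
          using cI[of "\<lambda>j. j - s" i] csum[OF i, of "\<lambda>j. j - s"] by simp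
        moreover have "[f i + g i = 2 * i] (mod p)" using fg[OF i] by simp
        ultimately show ?thesis
          by (metis cong_iff_dvd_diff cong_sym diff_diff_eq)
      qed
      have 2: "\<not> p dvd f s - s"
        using fg[OF s] separatedD[OF less.prems(4), of "f s" s] s by (auto simp: cong_iff_dvd_diff)
      show "\<exists>v. (\<forall>i\<in>I. q dvd (\<Sum>j\<in>I. c i j * v j)) \<and> (\<exists>i\<in>I. \<not> q dvd v i)"
        using 1 2 fg[OF s] s by (intro exI[of _ "\<lambda>j. j - s"]) (auto simp: I_def)
    next
      fix x :: "int \<Rightarrow> real" and i0
      assume x0: "\<And>i. i \<in> I \<Longrightarrow> (\<Sum>j\<in>I. of_int (c i j) * x j) = 0" and i0: "i0 \<in> I"
      have le: "y i \<le> 0" if y0: "\<And>i. i \<in> I \<Longrightarrow> (\<Sum>j\<in>I. of_int (c i j) * y j) = 0" and "i \<in> I"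
        for y :: "int \<Rightarrow> real" and i
      proof (rule ccontr)
        assume pos: "\<not> y i \<le> 0"
        \<comment> \<open>With the value 0 at \<open>s\<close> and a positive maximum,
          \<open>s\<close> stays outside the level set \<open>T\<close>, so \<open>T\<close> is a
          proper subset.\<close>
        define z where "z j = (if j = s then 0 else y j)" for j
        have z: "2 * z j = z (f j) + z (g j)" if "j \<in> I" for j
        proof -
          have j: "j \<in> S" using that by (simp add: I_def)
          have "(\<Sum>k\<in>I. of_int (c j k) * z k) = (\<Sum>k\<in>I. of_int (c j k) * y k)"
            by (intro sum.cong) (auto simp: z_def I_def)
          then show ?thesis using y0[OF that] cI[of z j] csum[OF j, of z] by (simp add: z_def)
        qed
        define T where "T = {a \<in> S. z a = Max (z ` S)}"
        have "z i > 0" "i \<in> S" using pos \<open>i \<in> I\<close> by (auto simp: z_def I_def)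
        then have M: "Max (z ` S) > 0" using fin by (meson Max_ge finite_imageI imageI less_le_trans)
        have "Max (z ` S) \<in> z ` S" using fin s by (intro Max_in) auto
        then have "T \<noteq> {}" by (auto simp: T_def)
        moreover have sT: "s \<notin> T" using M by (auto simp: T_def z_def)
        then have "T \<subset> S" using s by (auto simp: T_def)
        moreover have "midpoint_closed p T" unfolding midpoint_closed_def
        proof
          fix a assume a: "a \<in> T"
          then have aS: "a \<in> S" and aI: "a \<in> I" using sT by (auto simp: T_def I_def)
          have "z (f a) = Max (z ` S)" "z (g a) = Max (z ` S)"
            using Max_level_set_closed[OF fin aS _ _ _ z[OF aI]] fg[OF aS] a by (auto simp: T_def)
          then show "\<exists>b\<in>T. \<exists>c\<in>T. \<not> [b = a] (mod p) \<and> [b + c = 2 * a] (mod p)"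
            using fg[OF aS] separatedD[OF less.prems(4), of "f a" a] aS
            by (intro bexI[of _ "f a"] bexI[of _ "g a"]) (auto simp: T_def)
        qed
        ultimately show False using False by blast
      qed
      have "x i0 \<le> 0" by (rule le[OF x0 i0])
      moreover have "- x i0 \<le> 0"
        by (rule le[of "\<lambda>j. - x j", OF _ i0]) (simp add: x0 sum_negf)
      ultimately show "x i0 = 0" by simp
    next
      fix i assume "i \<in> I"
      then have i: "i \<in> S" by (simp add: I_def)
      have "(\<Sum>j\<in>I. (of_int (c i j) / 1)\<^sup>2) \<le> (\<Sum>j\<in>S. (of_int (c i j) / 1 :: real)\<^sup>2)"
        using fin by (intro sum_mono2) (auto simp: I_def)
      also have "\<dots> = (\<Sum>j\<in>S. 4 * (if j = i then 1 else 0) + (if j = f i then 1 else 0)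
          + (if j = g i then 1 else 0))"
        using fg[OF i] by (intro sum.cong) (auto simp: c_def)
      also have "\<dots> = 6" using fin i fg[OF i] by (simp add: sum.distrib sum_distrib_left[symmetric] sum.delta)
      finally show "(\<Sum>j\<in>I. (of_int (c i j) / 1)\<^sup>2) \<le> (6::real)" .
    qed (use finI p in auto)
    then have "of_int (p\<^sup>2) \<le> (of_int (6 ^ (card S - 1)) :: real)"
      using s fin by (simp add: I_def)
    then show ?thesis by (simp only: of_int_le_iff)
  qed
qed

subsection \<open>Chains of triples in symmetric sets\<close>

text \<open>Assumption \<open>leaves\<close> excludes full orbits of multiplication by 3, so every
  chain of triples starting at a nonzero element exits \<open>A\<close>. Full orbits are the subject
  of \<open>square_le_orbit\<close>.\<close>

locale tripling_chains =
  fixes p :: int and A :: "int set"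
  assumes prime_p: "prime p" and p_gt_3: "p > 3"
    and fin: "finite A" and sym: "a \<in> A \<Longrightarrow> - a \<in> A" and sep: "separated p A"
    and leaves: "a \<in> A \<Longrightarrow> a \<noteq> 0 \<Longrightarrow> \<exists>j. \<forall>b\<in>A. \<not> [b = 3 ^ j * a] (mod p)"
begin

definition reach :: "int \<Rightarrow> nat \<Rightarrow> bool" where
  "reach a j \<longleftrightarrow> (\<exists>b\<in>A. [b = 3 ^ j * a] (mod p))"

text \<open>Counts the triplings before the first exit from \<open>A\<close>; later multiples may
  re-enter \<open>A\<close> without affecting it.\<close>

definition height :: "int \<Rightarrow> nat" where
  "height a = (LEAST j. \<not> reach a (Suc j))"

definition end_point :: "int \<Rightarrow> int" where
  "end_point a = (SOME b. b \<in> A \<and> [b = 3 ^ height a * a] (mod p))"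

definition positives :: "int set" where
  "positives = {a \<in> A. 0 < a}"

definition chain_card :: "int \<Rightarrow> nat" where
  "chain_card i = card {b \<in> positives. \<bar>end_point b\<bar> = i}"

text \<open>These index the variables that survive the elimination: one for each pair
  \<open>{i, -i}\<close> whose triples are not in \<open>A\<close>.\<close>

definition ends :: "int set" where
  "ends = {a \<in> positives. \<not> reach a 1}"

text \<open>The value of an odd solution at \<open>a\<close>, expressed through its values at the positive chain ends,
  with the column of \<open>j\<close> multiplied by \<open>3\<^bsup>chain_card j - 1\<^esup>\<close> to make it integral.\<close>

definition coef :: "int \<Rightarrow> int \<Rightarrow> int" where
  "coef a j = (if a \<noteq> 0 \<and> j = \<bar>end_point a\<bar>
     then sgn (end_point a) * 3 ^ (chain_card j - 1 - height a) else 0)"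

lemma not_dvd_3: "\<not> p dvd 3 ^ j"
proof -
  have "\<not> p dvd 3" using p_gt_3 zdvd_imp_le[of p 3] by auto
  then show ?thesis using prime_p prime_dvd_power by blast
qed

lemma cong_cancel_3: "[3 ^ j * x = 3 ^ j * y] (mod p) \<Longrightarrow> [x = y] (mod p)"
  using not_dvd_3[of j] prime_p by (metis cong_mult_lcancel prime_imp_coprime coprime_commute)

lemma not_dvd: "a \<in> A \<Longrightarrow> a \<noteq> 0 \<Longrightarrow> \<not> p dvd a"
proof
  assume a: "a \<in> A" "a \<noteq> 0" "p dvd a"
  then have "[a = - a] (mod p)" by (simp add: cong_iff_dvd_diff)
  then have "a = - a" using separatedD[OF sep] a sym by blast
  then show False using a by simp
qed

lemma abs_mem: "a \<in> A \<Longrightarrow> \<bar>a\<bar> \<in> A"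
  using sym by (simp add: abs_if)

lemma reach_0: "a \<in> A \<Longrightarrow> reach a 0"
  unfolding reach_def by (rule bexI[of _ a]) simp_all

lemma reach_minus: "reach (- a) j = reach a j"
proof -
  have "reach (- a) j" if r: "reach a j" for a
  proof -
    obtain b where "b \<in> A" "[b = 3 ^ j * a] (mod p)" using r by (auto simp: reach_def)
    then show ?thesis unfolding reach_def
      by (intro bexI[of _ "- b"]) (simp_all add: sym cong_minus_minus_iff)
  qed
  from this[of a] this[of "- a"] show ?thesis by auto
qed

lemma height_minus: "height (- a) = height a"
  by (simp add: height_def reach_minus)

lemma height_abs: "height \<bar>a\<bar> = height a"
  by (simp add: abs_if height_minus)

lemma not_reach_Suc_height:
  assumes "a \<in> A" "a \<noteq> 0"
  shows "\<not> reach a (Suc (height a))"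
proof -
  obtain j where "\<not> reach a j" using leaves[OF assms] by (auto simp: reach_def)
  moreover have "reach a 0" using assms(1) by (rule reach_0)
  ultimately obtain i where "\<not> reach a (Suc i)" by (metis not0_implies_Suc)
  then show ?thesis unfolding height_def by (rule LeastI)
qed

lemma reach_le_height: "a \<in> A \<Longrightarrow> j \<le> height a \<Longrightarrow> reach a j"
proof (cases j)
  case 0
  then show "a \<in> A \<Longrightarrow> reach a j" by (simp add: reach_0)
next
  case (Suc i)
  then show "j \<le> height a \<Longrightarrow> reach a j" unfolding height_def
    using not_less_Least[of i "\<lambda>j. \<not> reach a (Suc j)"] by (auto simp: Suc_le_eq)
qed

lemma end_point:
  assumes "a \<in> A"
  shows "end_point a \<in> A" "[end_point a = 3 ^ height a * a] (mod p)"
  using someI_ex[of "\<lambda>b. b \<in> A \<and> [b = 3 ^ height a * a] (mod p)"] reach_le_height[OF assms order_refl]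
  unfolding end_point_def reach_def by blast+

lemma end_pointI:
  assumes "a \<in> A" "b \<in> A" "[b = 3 ^ height a * a] (mod p)"
  shows "end_point a = b"
  using separatedD[OF sep end_point(1) assms(2)] end_point(2) assms cong_trans cong_sym by blast

lemma end_point_minus:
  assumes "a \<in> A"
  shows "end_point (- a) = - end_point a"
  using end_point[OF assms] assms
  by (intro end_pointI) (simp_all add: sym height_minus cong_minus_minus_iff)

lemma abs_end_point_abs: "a \<in> A \<Longrightarrow> \<bar>end_point \<bar>a\<bar>\<bar> = \<bar>end_point a\<bar>"
  by (simp add: abs_if end_point_minus)

lemma end_point_nonzero:
  assumes "a \<in> A" "a \<noteq> 0"
  shows "end_point a \<noteq> 0"
proof
  assume "end_point a = 0"
  then have "p dvd 3 ^ height a * a" using end_point(2)[OF assms(1)]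
    by (simp add: cong_0_iff cong_sym_eq[of 0])
  then show False using not_dvd_3 not_dvd[OF assms] prime_dvd_multD[OF prime_p] by blast
qed

lemma end_point_height_0:
  assumes "a \<in> A" "height a = 0"
  shows "end_point a = a"
  using assms by (intro end_pointI) auto

lemma not_reach_end_point:
  assumes "a \<in> A" "a \<noteq> 0"
  shows "\<not> reach (end_point a) 1"
proof
  assume "reach (end_point a) 1"
  then obtain b where b: "b \<in> A" "[b = 3 * end_point a] (mod p)" by (auto simp: reach_def)
  have "[3 * end_point a = 3 ^ Suc (height a) * a] (mod p)"
    using cong_scalar_left[OF end_point(2)[OF assms(1)], of 3] by (simp add: mult.assoc)
  then have "reach a (Suc (height a))" using b cong_trans unfolding reach_def by blast
  then show False using not_reach_Suc_height[OF assms] by simp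
qed

lemma abs_end_point_in_ends:
  assumes "a \<in> A" "a \<noteq> 0"
  shows "\<bar>end_point a\<bar> \<in> ends"
  using assms end_point(1)[OF assms(1)] end_point_nonzero[OF assms] not_reach_end_point[OF assms]
    abs_mem by (simp add: ends_def positives_def) (simp add: abs_if reach_minus)

lemma endsD:
  assumes "i \<in> ends"
  shows "i \<in> A" "i > 0" "height i = 0" "end_point i = i"
proof -
  show i: "i \<in> A" "i > 0" using assms by (auto simp: ends_def positives_def)
  show "height i = 0"
    using assms reach_le_height[OF i(1), of 1] by (cases "height i") (auto simp: ends_def)
  then show "end_point i = i" using i by (simp add: end_point_height_0)
qed

text \<open>The elements \<open>a, 3a, \<dots>, 3\<^sup>ha\<close> of a chain have pairwise distinct heights.\<close>

lemma height_less_chain_card: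
  assumes a: "a \<in> A" "a \<noteq> 0"
  shows "height a < chain_card \<bar>end_point a\<bar>"
proof -
  let ?F = "{b \<in> positives. \<bar>end_point b\<bar> = \<bar>end_point a\<bar>}"
  have finF: "finite ?F" using fin by (simp add: positives_def)
  have "{..height a} \<subseteq> height ` ?F"
  proof
    fix i assume "i \<in> {..height a}"
    then have i: "i \<le> height a" by simp
    define j where "j = height a - i"
    obtain b where b: "b \<in> A" "[b = 3 ^ j * a] (mod p)"
      using reach_le_height[OF a(1), of j] by (auto simp: j_def reach_def)
    have b0: "b \<noteq> 0"
    proof
      assume "b = 0"
      then have "p dvd 3 ^ j * a" using b(2) by (simp add: cong_0_iff cong_sym_eq[of 0])
      then show False using not_dvd_3 not_dvd[OF a] prime_dvd_multD[OF prime_p] by blast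
    qed
    have sc: "[3 ^ m * b = 3 ^ (j + m) * a] (mod p)" for m
      using cong_scalar_left[OF b(2), of "3 ^ m"] by (simp add: power_add mult_ac)
    have r: "reach b m = reach a (j + m)" for m
      using sc[of m] unfolding reach_def by (meson cong_sym cong_trans)
    have h: "height b = i" unfolding height_def
    proof (rule Least_equality)
      show "\<not> reach b (Suc i)" using not_reach_Suc_height[OF a] i by (simp add: r j_def)
      show "i \<le> m" if "\<not> reach b (Suc m)" for m
      proof (rule ccontr)
        assume "\<not> i \<le> m"
        then have "j + Suc m \<le> height a" using i by (simp add: j_def)
        then show False using that reach_le_height[OF a(1)] r by blast
      qed
    qed
    have "end_point b = end_point a"
    proof (rule end_pointI[OF b(1) end_point(1)[OF a(1)]])
      have "[3 ^ i * b = 3 ^ height a * a] (mod p)" using sc[of i] i by (simp add: j_def)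
      then show "[end_point a = 3 ^ height b * b] (mod p)"
        unfolding h using end_point(2)[OF a(1)] cong_sym cong_trans by blast
    qed
    then have "\<bar>b\<bar> \<in> ?F" using b b0 by (simp add: positives_def abs_mem abs_end_point_abs)
    moreover have "height \<bar>b\<bar> = i" using h by (simp add: height_abs)
    ultimately show "i \<in> height ` ?F" by blast
  qed
  then have "card {..height a} \<le> card ?F" using finF by (rule surj_card_le[rotated])
  then show ?thesis by (simp add: chain_card_def)
qed

text \<open>Every positive element belongs to exactly one end; this later turns a product over ends
  into a power with exponent \<open>card positives\<close>.\<close>

lemma sum_chain_card: "(\<Sum>i\<in>ends. chain_card i) = card positives"
proof -
  have "(\<Sum>i\<in>ends. \<Sum>b\<in>{b \<in> positives. \<bar>end_point b\<bar> = i}. 1) = (\<Sum>b\<in>positives. 1::nat)"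
    using fin abs_end_point_in_ends
    by (intro sum.group) (auto simp: positives_def ends_def)
  then show ?thesis by (simp add: chain_card_def)
qed

lemma chain_card_pos: "i \<in> ends \<Longrightarrow> 0 < chain_card i"
  using height_less_chain_card[of i] endsD[of i] by simp

section \<open>Odd solutions in terms of the chain ends\<close>

lemma coef_minus: "a \<in> A \<Longrightarrow> coef (- a) j = - coef a j"
  by (auto simp: coef_def end_point_minus height_minus sgn_minus)

lemma coef_0: "coef 0 j = 0"
  by (simp add: coef_def)

lemma sum_coef:
  fixes x :: "int \<Rightarrow> 'b::comm_ring_1"
  assumes "a \<in> A"
  shows "(\<Sum>j\<in>ends. of_int (coef a j) * x j) =
    (if a = 0 then 0 else of_int (coef a \<bar>end_point a\<bar>) * x \<bar>end_point a\<bar>)"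
proof (cases "a = 0")
  case False
  have "finite ends" using fin by (simp add: ends_def positives_def)
  moreover have "(\<Sum>j\<in>ends. of_int (coef a j) * x j)
    = (\<Sum>j\<in>ends. if j = \<bar>end_point a\<bar> then of_int (coef a j) * x j else 0)"
    by (intro sum.cong) (auto simp: coef_def)
  ultimately show ?thesis using False abs_end_point_in_ends[OF assms False] by simp
qed (simp add: coef_0)

lemma coef_end_point:
  assumes "a \<in> A" "a \<noteq> 0"
  shows "coef a \<bar>end_point a\<bar> * 3 ^ height a = sgn (end_point a) * 3 ^ (chain_card \<bar>end_point a\<bar> - 1)"
proof -
  have "chain_card \<bar>end_point a\<bar> - 1 - height a + height a = chain_card \<bar>end_point a\<bar> - 1"
    using height_less_chain_card[OF assms] by linarith
  then show ?thesis using assms(2) by (simp add: coef_def mult.assoc power_add[symmetric])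
qed

section \<open>Norms of the rescaled rows\<close>

lemma coef_scaled:
  "(of_int (coef a j) :: real) / 3 ^ (chain_card j - 1) =
     (if a \<noteq> 0 \<and> j = \<bar>end_point a\<bar> then of_int (sgn (end_point a)) / 3 ^ height a else 0)"
  if a: "a \<in> A"
proof (cases "a \<noteq> 0 \<and> j = \<bar>end_point a\<bar>")
  case True
  have "of_int (coef a j * 3 ^ height a) = (of_int (sgn (end_point a) * 3 ^ (chain_card j - 1)) :: real)"
    using coef_end_point[OF a] True by simp
  then show ?thesis using True by (simp add: field_simps)
qed (auto simp: coef_def)

definition scaled_coef :: "int \<Rightarrow> real" where
  "scaled_coef a = (if a = 0 then 0 else of_int (sgn (end_point a)) / 3 ^ height a)"

text \<open>A rescaled coefficient vector has at most one nonzero entry, so an inner product is a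
  single product, present only if both chains end in the same pair.\<close>

definition coef_ip :: "int \<Rightarrow> int \<Rightarrow> real" where
  "coef_ip a b = (if \<bar>end_point a\<bar> = \<bar>end_point b\<bar> then scaled_coef a * scaled_coef b else 0)"

lemma sum_coef_scaled_mult:
  assumes "a \<in> A" "b \<in> A"
  shows "(\<Sum>j\<in>ends. (of_int (coef a j) / 3 ^ (chain_card j - 1)) * (of_int (coef b j) / 3 ^ (chain_card j - 1)))
    = coef_ip a b"
proof -
  have fE: "finite ends" using fin by (simp add: ends_def positives_def)
  have "(\<Sum>j\<in>ends. (of_int (coef a j) / 3 ^ (chain_card j - 1)) * (of_int (coef b j) / 3 ^ (chain_card j - 1)))
    = (\<Sum>j\<in>ends. if j = \<bar>end_point a\<bar> then coef_ip a b else 0)"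
    unfolding coef_scaled[OF assms(1)] coef_scaled[OF assms(2)]
    by (intro sum.cong) (auto simp: coef_ip_def scaled_coef_def)
  also have "\<dots> = (if \<bar>end_point a\<bar> \<in> ends then coef_ip a b else 0)" using fE by simp
  also have "\<dots> = coef_ip a b"
    using abs_end_point_in_ends[OF assms(1)] by (auto simp: coef_ip_def scaled_coef_def)
  finally show ?thesis .
qed

lemma scaled_coef_bound:
  assumes "j \<le> height a"
  shows "\<bar>scaled_coef a\<bar> \<le> 1 / 3 ^ j"
proof -
  have "\<bar>scaled_coef a\<bar> \<le> 1 / 3 ^ height a"
    by (auto simp: scaled_coef_def abs_mult abs_divide sgn_if)
  also have "\<dots> \<le> 1 / 3 ^ j" using assms by (simp add: frac_le)
  finally show ?thesis .
qed

text \<open>If both heights are 0, a common column means \<open>c = - b\<close> and the product is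
  not positive; otherwise one factor is at most 1/3 in absolute value.\<close>

lemma coef_ip_le:
  assumes b: "b \<in> A" and c: "c \<in> A" and bc: "b \<noteq> c"
  shows "coef_ip b c \<le> 1 / 3"
proof (cases "height b = 0 \<and> height c = 0")
  case True
  then have "end_point b = b" "end_point c = c" using b c by (simp_all add: end_point_height_0)
  then show ?thesis using bc True by (auto simp: coef_ip_def scaled_coef_def sgn_if abs_if)
next
  case False
  have "\<bar>scaled_coef b\<bar> * \<bar>scaled_coef c\<bar> \<le> 1 / 3"
  proof (cases "height b = 0")
    case True
    then have "\<bar>scaled_coef c\<bar> \<le> 1 / 3" using False scaled_coef_bound[of 1 c] by simp
    then show ?thesis
      using scaled_coef_bound[of 0 b] mult_mono[of "\<bar>scaled_coef b\<bar>" 1 "\<bar>scaled_coef c\<bar>" "1/3"] by simp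
  next
    case False
    then have "\<bar>scaled_coef b\<bar> \<le> 1 / 3" using scaled_coef_bound[of 1 b] by simp
    then show ?thesis
      using scaled_coef_bound[of 0 c] mult_mono[of "\<bar>scaled_coef b\<bar>" "1/3" "\<bar>scaled_coef c\<bar>" 1] by simp
  qed
  moreover have "scaled_coef b * scaled_coef c \<le> \<bar>scaled_coef b\<bar> * \<bar>scaled_coef c\<bar>"
    using abs_ge_self[of "scaled_coef b * scaled_coef c"] by (simp add: abs_mult)
  ultimately show ?thesis by (simp add: coef_ip_def)
qed

text \<open>The left side is the share of a neighbour \<open>b\<close> in the squared norm of the
  row of \<open>i\<close>. If both chains end in the same pair, \<open>b\<close> has positive
  height, so its entry is at most 1/3 in absolute value and its share at most 1/9 + 4/3. Otherwise
  the cross term vanishes and the share is at most 1. The neighbour \<open>- i\<close> would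
  contribute 5.\<close>

lemma coef_ip_self_le:
  assumes i: "i \<in> ends" and b: "b \<in> A" "b \<noteq> i" "b \<noteq> - i"
  shows "coef_ip b b - 4 * coef_ip i b \<le> 13 / 9"
proof -
  have si: "scaled_coef i = 1" using endsD[OF i] by (simp add: scaled_coef_def)
  show ?thesis
  proof (cases "\<bar>end_point b\<bar> = \<bar>end_point i\<bar>")
    case True
    have "height b \<noteq> 0"
      using True end_point_height_0[OF b(1)] endsD[OF i] b(2,3) by (auto simp: abs_if split: if_splits)
    then have s: "\<bar>scaled_coef b\<bar> \<le> 1 / 3" using scaled_coef_bound[of 1 b] by simp
    have "(scaled_coef b)\<^sup>2 \<le> (1 / 3)\<^sup>2" using s by (simp add: abs_le_square_iff[symmetric])
    then have "scaled_coef b * scaled_coef b \<le> 1 / 9" by (simp add: power2_eq_square)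
    moreover have "- scaled_coef b \<le> 1 / 3" using s by linarith
    ultimately show ?thesis using True si by (simp add: coef_ip_def)
  next
    case False
    have "\<bar>scaled_coef b\<bar> \<le> 1" using scaled_coef_bound[of 0 b] by simp
    then have "(scaled_coef b)\<^sup>2 \<le> 1" by (simp add: abs_square_le_1)
    then have "scaled_coef b * scaled_coef b \<le> 1" by (simp add: power2_eq_square)
    then show ?thesis using False by (simp add: coef_ip_def)
  qed
qed

text \<open>The estimates add up to 4 + 13/9 + 13/9 + 2/3 = 68/9. What counts is that the bound does
  not exceed 9, the factor allotted to each end.\<close>

lemma row_norm_le:
  assumes i: "i \<in> ends" and b: "b \<in> A" "b \<noteq> i" "b \<noteq> - i" and c: "c \<in> A" "c \<noteq> i" "c \<noteq> - i"
    and bc: "b \<noteq> c"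
  shows "(\<Sum>j\<in>ends. (of_int (2 * coef i j - coef b j - coef c j) / 3 ^ (chain_card j - 1))\<^sup>2) \<le> (8 :: real)"
proof -
  let ?s = "\<lambda>a j. (of_int (coef a j) :: real) / 3 ^ (chain_card j - 1)"
  have iA: "i \<in> A" using endsD[OF i] by simp
  have "(\<Sum>j\<in>ends. (of_int (2 * coef i j - coef b j - coef c j) / 3 ^ (chain_card j - 1))\<^sup>2)
    = (\<Sum>j\<in>ends. 4 * (?s i j * ?s i j) + ?s b j * ?s b j + ?s c j * ?s c j
       - 4 * (?s i j * ?s b j) - 4 * (?s i j * ?s c j) + 2 * (?s b j * ?s c j))"
    by (intro sum.cong refl)
      (simp add: diff_divide_distrib power2_eq_square left_diff_distrib right_diff_distrib mult_ac)
  also have "\<dots> = 4 * coef_ip i i + coef_ip b b + coef_ip c c - 4 * coef_ip i b - 4 * coef_ip i c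
      + 2 * coef_ip b c"
    using sum_coef_scaled_mult iA b(1) c(1)
    by (simp add: sum.distrib sum_subtractf sum_distrib_left[symmetric] del: times_divide_eq_left times_divide_eq_right)
  also have "\<dots> \<le> 8"
    using coef_ip_self_le[OF i b] coef_ip_self_le[OF i c] coef_ip_le[OF b(1) c(1) bc] endsD[OF i]
    by (simp add: coef_ip_def[of i i] scaled_coef_def[of i])
  finally show ?thesis .
qed

text \<open>The identity solves the equations modulo \<open>p\<close>. As 3 is invertible, it can be
  written in the rescaled variables: \<open>v j\<close> is \<open>j\<close> divided by
  \<open>3 ^ (chain_card j - 1)\<close>.\<close>

lemma sum_coef_cong:
  obtains v where "\<And>a. a \<in> A \<Longrightarrow> [(\<Sum>j\<in>ends. coef a j * v j) = a] (mod p)"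
proof -
  have "\<exists>v. [3 ^ (chain_card j - 1) * v = j] (mod p)" for j
  proof -
    have "coprime (3 ^ (chain_card j - 1)) p"
      using not_dvd_3 prime_p prime_imp_coprime coprime_commute by blast
    then obtain u where "[3 ^ (chain_card j - 1) * u = 1] (mod p)"
      using cong_solve_coprime_int by blast
    from cong_scalar_right[OF this, of j] show ?thesis by (auto simp: mult.assoc)
  qed
  then obtain v where v: "\<And>j. [3 ^ (chain_card j - 1) * v j = j] (mod p)" by metis
  have "[(\<Sum>j\<in>ends. coef a j * v j) = a] (mod p)" if a: "a \<in> A" for a
  proof (cases "a = 0")
    case True
    then show ?thesis by (simp add: coef_0)
  next
    case False
    let ?J = "\<bar>end_point a\<bar>"
    have "3 ^ height a * (coef a ?J * v ?J) = sgn (end_point a) * (3 ^ (chain_card ?J - 1) * v ?J)"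
      using coef_end_point[OF a False] by (simp add: mult_ac)
    also have "[\<dots> = sgn (end_point a) * ?J] (mod p)" by (rule cong_scalar_left[OF v])
    also have "sgn (end_point a) * ?J = end_point a" by (simp add: sgn_mult_abs)
    also have "[end_point a = 3 ^ height a * a] (mod p)" by (rule end_point(2)[OF a])
    finally have "[coef a ?J * v ?J = a] (mod p)" by (rule cong_cancel_3)
    then show ?thesis using sum_coef[OF a, of v] False by simp
  qed
  then show ?thesis using that by blast
qed

text \<open>A nonzero element has a single nonzero coefficient, a power of 3 up to sign. This makes
  the constant vector 1 a solution modulo 2 if 0 is not in \<open>A\<close>.\<close>

lemma odd_sum_coef:
  assumes "a \<in> A" "a \<noteq> 0"
  shows "odd (\<Sum>j\<in>ends. coef a j)"
proof -
  have "odd (coef a \<bar>end_point a\<bar>)"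
    using end_point_nonzero[OF assms] assms(2) by (auto simp: coef_def sgn_if)
  then show ?thesis using sum_coef[OF assms(1), of "\<lambda>_. 1 :: int"] assms(2) by simp
qed

text \<open>A kernel vector extends to an odd function \<open>y\<close> on \<open>A\<close> that
  triples at each step along a chain. A positive maximum is thus attained only at chain ends up to
  sign, where the equations hold, so its level set is midpoint closed. Then \<open>nosym\<close>
  gives a point and its negative with the same positive value, against oddness.\<close>

lemma kernel_trivial:
  fixes x :: "int \<Rightarrow> real" and f g :: "int \<Rightarrow> int"
  assumes nosym: "\<And>S. S \<subseteq> A \<Longrightarrow> S \<noteq> {} \<Longrightarrow> midpoint_closed p S \<Longrightarrow> \<exists>a\<in>S. - a \<in> S"
    and fg: "\<And>a. a \<in> A \<Longrightarrow> f a \<in> A \<and> g a \<in> A \<and> f a \<noteq> a \<and> g a \<noteq> a \<and> f a \<noteq> g a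
      \<and> [f a + g a = 2 * a] (mod p)"
    and x: "\<And>i. i \<in> ends \<Longrightarrow> (\<Sum>j\<in>ends. of_int (2 * coef i j - coef (f i) j - coef (g i) j) * x j) = 0"
    and i: "i \<in> ends"
  shows "x i = 0"
proof (rule ccontr)
  assume xi: "x i \<noteq> 0"
  define y where "y a = (\<Sum>j\<in>ends. of_int (coef a j) * x j)" for a
  have y_minus: "y (- a) = - y a" if "a \<in> A" for a
    using that by (simp add: y_def coef_minus sum_negf)
  have y_end: "2 * y a = y (f a) + y (g a)" if "a \<in> ends" for a
    using x[OF that] by (simp add: y_def left_diff_distrib sum_subtractf sum_distrib_left mult.assoc)
  have y_nz: "y a = of_int (coef a \<bar>end_point a\<bar>) * x \<bar>end_point a\<bar>" if "a \<in> A" "a \<noteq> 0" for a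
    using sum_coef[OF that(1), of x] that(2) by (simp add: y_def)
  have y_height: "y (end_point a) = 3 ^ height a * y a" if a: "a \<in> A" "a \<noteq> 0" for a
  proof -
    let ?e = "end_point a"
    have e: "?e \<in> A" "?e \<noteq> 0" using end_point(1) end_point_nonzero a by auto
    have h: "height ?e = 0"
      using not_reach_end_point[OF a] reach_le_height[OF e(1), of 1] by (cases "height ?e") auto
    then have ee: "end_point ?e = ?e" using e(1) end_point_height_0 by blast
    have "coef ?e \<bar>?e\<bar> = 3 ^ height a * coef a \<bar>?e\<bar>"
      using coef_end_point[OF a] coef_end_point[OF e] ee h by (simp add: mult.commute)
    then show ?thesis using y_nz[OF a] y_nz[OF e] ee by simp
  qed
  define M where "M = Max (y ` A)"
  have le: "y a \<le> M" if "a \<in> A" for a using that fin by (simp add: M_def)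
  have iA: "i \<in> A" "i \<noteq> 0" using endsD[OF i] by auto
  have "y i \<noteq> 0"
    using y_nz[OF iA] xi endsD[OF i] by (simp add: coef_def)
  then have M: "M > 0"
    using le[OF iA(1)] le[OF sym[OF iA(1)]] y_minus[OF iA(1)] by linarith
  have "M \<in> y ` A" unfolding M_def using fin iA by (intro Max_in) auto
  define S where "S = {a \<in> A. y a = M}"
  have S_ends: "\<bar>a\<bar> \<in> ends" if "a \<in> S" for a
  proof -
    have a: "a \<in> A" "y a = M" using that by (auto simp: S_def)
    then have a0: "a \<noteq> 0" using M by (auto simp: y_def coef_0)
    have "height a = 0"
    proof (rule ccontr)
      assume "height a \<noteq> 0"
      then have "(3::real) ^ height a > 1" by simp
      then have "3 ^ height a * M > M" using M by simp
      then show False using y_height[OF a(1) a0] a(2) le[OF end_point(1)[OF a(1)]] by simp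
    qed
    then have "end_point a = a" using a(1) end_point_height_0 by blast
    then show ?thesis using abs_end_point_in_ends[OF a(1) a0] by simp
  qed
  have "midpoint_closed p S" unfolding midpoint_closed_def
  proof
    fix a assume a: "a \<in> S"
    then have aA: "a \<in> A" "y a = M" by (auto simp: S_def)
    show "\<exists>b\<in>S. \<exists>c\<in>S. \<not> [b = a] (mod p) \<and> [b + c = 2 * a] (mod p)"
    proof (cases "a > 0")
      case True
      then have E: "a \<in> ends" using S_ends[OF a] by simp
      note F = fg[OF aA(1)]
      have "y (f a) = M" "y (g a) = M"
        using Max_level_set_closed[OF fin aA(1) _ _ _ y_end[OF E]] F aA(2) by (auto simp: M_def)
      then show ?thesis
        using F separatedD[OF sep, of "f a" a] aA
        by (intro bexI[of _ "f a"] bexI[of _ "g a"]) (auto simp: S_def)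
    next
      case False
      have "a \<noteq> 0" using aA M by (auto simp: y_def coef_0)
      then have E: "- a \<in> ends" using False S_ends[OF a] by simp
      \<comment> \<open>Equations are given only at positive ends; at a negative one the equation of
        \<open>- a\<close> is reflected.\<close>
      note F = fg[OF sym[OF aA(1)]]
      let ?b = "- f (- a)" and ?c = "- g (- a)"
      have bA: "?b \<in> A" "?c \<in> A" using F sym by auto
      have "2 * y a = y ?b + y ?c"
        using y_end[OF E] y_minus[of a] y_minus[of "f (- a)"] y_minus[of "g (- a)"] F aA(1) by simp
      then have "y ?b = M" "y ?c = M"
        using Max_level_set_closed[OF fin aA(1) _ bA] aA(2) by (auto simp: M_def)
      moreover have "\<not> [?b = a] (mod p)"
        using separatedD[OF sep bA(1) aA(1)] F by auto
      moreover have "[?b + ?c = 2 * a] (mod p)"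
      proof -
        have "[- (f (- a) + g (- a)) = - (2 * (- a))] (mod p)"
          using F by (subst cong_minus_minus_iff) blast
        then show ?thesis by simp
      qed
      ultimately show ?thesis using bA
        by (intro bexI[of _ ?b] bexI[of _ ?c] conjI) (simp_all add: S_def)
    qed
  qed
  moreover have "S \<subseteq> A" "S \<noteq> {}" using \<open>M \<in> y ` A\<close> by (auto simp: S_def)
  ultimately obtain a where "a \<in> S" "- a \<in> S" using nosym by blast
  then show False using y_minus[of a] M by (auto simp: S_def)
qed

lemma square_le_chains:
  assumes nosym: "\<And>S. S \<subseteq> A \<Longrightarrow> S \<noteq> {} \<Longrightarrow> midpoint_closed p S \<Longrightarrow> \<exists>a\<in>S. - a \<in> S"
    and mp: "midpoint_closed p A" and ne: "A \<noteq> {}"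
  shows "((if 0 \<in> A then 1 else 2) * p)\<^sup>2 \<le> 9 ^ card positives"
proof -
  obtain f g where fg: "\<And>a. a \<in> A \<Longrightarrow> f a \<in> A \<and> g a \<in> A \<and> f a \<noteq> a \<and> g a \<noteq> a \<and> f a \<noteq> g a
      \<and> [f a + g a = 2 * a] (mod p)"
    by (rule midpoints[OF prime_p _ mp sep]) (use p_gt_3 in auto)
  obtain a where a: "a \<in> A" "a \<noteq> 0" using ne fg by (metis all_not_in_conv)
  define i0 where "i0 = \<bar>end_point a\<bar>"
  have i0: "i0 \<in> ends" using abs_end_point_in_ends[OF a] by (simp add: i0_def)
  have fE: "finite ends" using fin by (simp add: ends_def positives_def)
  obtain v where v: "\<And>a. a \<in> A \<Longrightarrow> [(\<Sum>j\<in>ends. coef a j * v j) = a] (mod p)"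
    by (rule sum_coef_cong) blast
  \<comment> \<open>The equation at an end after elimination; the tripling equations are already
    built into \<open>coef\<close>.\<close>
  define c where "c i j = 2 * coef i j - coef (f i) j - coef (g i) j" for i j
  have csum: "(\<Sum>j\<in>ends. c i j * u j) = 2 * (\<Sum>j\<in>ends. coef i j * u j) - (\<Sum>j\<in>ends. coef (f i) j * u j)
      - (\<Sum>j\<in>ends. coef (g i) j * u j)" for i u
    by (simp add: c_def left_diff_distrib sum_subtractf sum_distrib_left mult.assoc)
  have solp: "\<exists>v. (\<forall>i\<in>ends. p dvd (\<Sum>j\<in>ends. c i j * v j)) \<and> (\<exists>i\<in>ends. \<not> p dvd v i)"
  proof (intro exI[of _ v] conjI ballI)
    fix i assume "i \<in> ends"
    then have i: "i \<in> A" using endsD by blast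
    note F = fg[OF i]
    have "[(\<Sum>j\<in>ends. c i j * v j) = 2 * i - f i - g i] (mod p)"
      unfolding csum using F i by (intro cong_diff cong_scalar_left v) auto
    moreover have "[2 * i - f i - g i = 0] (mod p)"
      using F by (simp add: cong_iff_dvd_diff dvd_diff_commute algebra_simps)
    ultimately show "p dvd (\<Sum>j\<in>ends. c i j * v j)" using cong_trans cong_0_iff by blast
  next
    have "\<not> (\<forall>i\<in>ends. p dvd v i)"
    proof
      assume "\<forall>i\<in>ends. p dvd v i"
      then have "p dvd (\<Sum>j\<in>ends. coef a j * v j)" by (intro dvd_sum) auto
      then have "p dvd a" using v[OF a(1)] cong_dvd_iff cong_sym by blast
      then show False using not_dvd[OF a] by simp
    qed
    then show "\<exists>i\<in>ends. \<not> p dvd v i" by blast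
  qed
  \<comment> \<open>Without 0 every value of the constant solution is odd, so a row sum is an even
    number minus two odd ones.\<close>
  have sol2: "\<exists>v. (\<forall>i\<in>ends. 2 dvd (\<Sum>j\<in>ends. c i j * v j)) \<and> (\<exists>i\<in>ends. \<not> 2 dvd v i)" if z: "0 \<notin> A"
  proof (intro exI[of _ "\<lambda>_. 1"] conjI ballI)
    fix i assume "i \<in> ends"
    then have i: "i \<in> A" using endsD by blast
    have "odd (\<Sum>j\<in>ends. coef (f i) j)" "odd (\<Sum>j\<in>ends. coef (g i) j)"
      using fg[OF i] z by (intro odd_sum_coef; metis)+
    then show "2 dvd (\<Sum>j\<in>ends. c i j * 1)" unfolding csum by simp
  qed (use i0 in auto)
  define P where "P = (if 0 \<in> A then {p} else {2, p})"
  have prodP: "\<Prod>P = (if 0 \<in> A then 1 else 2) * p" using p_gt_3 by (auto simp: P_def)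
  have "(of_int (\<Prod>P))\<^sup>2 \<le> (8::real) ^ card ends * (\<Prod>j\<in>ends. (3 ^ (chain_card j - 1) :: real)\<^sup>2)"
  proof (rule prod_primes_le_det_bound[where c = c])
    show "\<exists>v. (\<forall>i\<in>ends. q dvd (\<Sum>j\<in>ends. c i j * v j)) \<and> (\<exists>i\<in>ends. \<not> q dvd v i)" if "q \<in> P" for q
      using that solp sol2 by (auto simp: P_def split: if_splits)
  next
    fix x :: "int \<Rightarrow> real" and i
    assume x: "\<And>i. i \<in> ends \<Longrightarrow> (\<Sum>j\<in>ends. of_int (c i j) * x j) = 0" and i: "i \<in> ends"
    show "x i = 0" by (rule kernel_trivial[OF nosym fg x[unfolded c_def] i])
  next
    fix i assume i: "i \<in> ends"
    then have iA: "i \<in> A" using endsD by blast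
    note F = fg[OF iA]
    \<comment> \<open>At an end \<open>i\<close>, the neighbour \<open>- i\<close> would force the
      other neighbour to be \<open>3 * i\<close> modulo \<open>p\<close>, which is not in
      \<open>A\<close>.\<close>
    have nr: "b \<noteq> - i" if "b \<in> A" "c \<in> A" "[b + c = 2 * i] (mod p)" for b c
    proof
      assume "b = - i"
      then have "[c = 3 * i] (mod p)" using that(3) by (simp add: cong_iff_dvd_diff algebra_simps)
      then show False using that(2) i by (auto simp: ends_def reach_def)
    qed
    show "(\<Sum>j\<in>ends. (of_int (c i j) / 3 ^ (chain_card j - 1))\<^sup>2) \<le> (8::real)"
      unfolding c_def using F nr[of "f i" "g i"] nr[of "g i" "f i"]
      by (intro row_norm_le[OF i]) (auto simp: add.commute)
  qed (use fE prime_p in \<open>auto simp: P_def split: if_splits\<close>)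
  also have "\<dots> = (\<Prod>j\<in>ends. 8 * (3 ^ (chain_card j - 1))\<^sup>2)" by (simp add: prod.distrib)
  \<comment> \<open>The squared column weight is \<open>9 ^ (chain_card j - 1)\<close>, and the row
    bound 8 is below the one remaining factor 9.\<close>
  also have "\<dots> \<le> (\<Prod>j\<in>ends. 9 ^ chain_card j)"
  proof (intro prod_mono conjI)
    fix j assume j: "j \<in> ends"
    have "8 * ((3::real) ^ (chain_card j - 1))\<^sup>2 \<le> 9 * 9 ^ (chain_card j - 1)"
      by (simp add: power2_eq_square power_mult_distrib[symmetric])
    also have "\<dots> = 9 ^ chain_card j"
      using chain_card_pos[OF j] by (simp add: power_Suc[symmetric] del: power_Suc)
    finally show "8 * ((3::real) ^ (chain_card j - 1))\<^sup>2 \<le> 9 ^ chain_card j" .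
  qed simp
  also have "\<dots> = 9 ^ card positives" by (simp add: power_sum[symmetric] sum_chain_card)
  finally have "of_int (((if 0 \<in> A then 1 else 2) * p)\<^sup>2) \<le> (of_int (9 ^ card positives) :: real)"
    unfolding prodP by simp
  then show ?thesis by (simp only: of_int_le_iff)
qed

end

subsection \<open>The lower bound\<close>

lemma card_symmetric:
  fixes A :: "int set"
  assumes fin: "finite A" and sym: "\<And>a. a \<in> A \<Longrightarrow> - a \<in> A"
  shows "card A = 2 * card {a \<in> A. 0 < a} + (if 0 \<in> A then 1 else 0)"
proof -
  let ?P = "{a \<in> A. 0 < a}"
  have A: "A = (?P \<union> uminus ` ?P) \<union> (A \<inter> {0})"
    using sym by (auto simp: image_iff) (metis add.inverse_inverse linorder_neqE_linordered_idom neg_0_less_iff_less)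
  have "card A = card (?P \<union> uminus ` ?P) + card (A \<inter> {0})"
    by (subst A, rule card_Un_disjoint) (use fin in auto)
  also have "card (?P \<union> uminus ` ?P) = card ?P + card (uminus ` ?P)"
    by (rule card_Un_disjoint) (use fin in auto)
  also have "card (uminus ` ?P) = card ?P" by (intro card_image) (auto simp: inj_on_def)
  finally show ?thesis by simp
qed

text \<open>If \<open>A\<close> contains a full orbit of multiplication by 3, then \<open>p\<close> divides \<open>3\<^sup>m - 1\<close> or \<open>3\<^sup>m + 1\<close>,
  both of which are even, for some \<open>m\<close> not exceeding the number of pairs \<open>{a, -a}\<close>.\<close>

lemma square_le_orbit:
  fixes p :: int
  assumes p: "prime p" "p > 3" and fin: "finite A" and sym: "\<And>a. a \<in> A \<Longrightarrow> - a \<in> A"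
    and a: "\<not> p dvd a" and orbit: "\<And>j. \<exists>b\<in>A. [b = 3 ^ j * a] (mod p)"
  shows "3 * p\<^sup>2 \<le> 9 ^ card {a \<in> A. 0 < a}"
proof -
  let ?P = "{a \<in> A. 0 < a}"
  define k where "k = card ?P"
  have "\<not> p dvd 3" using p zdvd_imp_le[of p 3] by auto
  then have n3: "\<not> p dvd 3 ^ j" for j using p(1) prime_dvd_power by blast
  obtain b where b: "\<And>j. b j \<in> A" "\<And>j. [b j = 3 ^ j * a] (mod p)" using orbit by metis
  have b0: "b j \<noteq> 0" for j
  proof
    assume "b j = 0"
    then have "p dvd 3 ^ j * a" using b(2)[of j] by (simp add: cong_0_iff cong_sym_eq[of 0])
    then show False using n3 a prime_dvd_multD[OF p(1)] by blast
  qed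
  have "\<bar>b j\<bar> \<in> ?P" for j using b(1)[of j] b0[of j] sym by (simp add: abs_if)
  \<comment> \<open>Pigeonhole: \<open>k + 1\<close> exponents share \<open>k\<close> absolute
    values, so two multiples agree up to sign.\<close>
  then have "(\<lambda>j. \<bar>b j\<bar>) ` {..k} \<subseteq> ?P" by blast
  then have "card ((\<lambda>j. \<bar>b j\<bar>) ` {..k}) < card {..k}"
    using fin card_mono[of ?P "(\<lambda>j. \<bar>b j\<bar>) ` {..k}"] by (simp add: k_def)
  then have "\<not> inj_on (\<lambda>j. \<bar>b j\<bar>) {..k}" by (metis card_image less_irrefl)
  then obtain i' j' where "i' \<le> k" "j' \<le> k" "i' \<noteq> j'" "\<bar>b i'\<bar> = \<bar>b j'\<bar>"
    by (auto simp: inj_on_def)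
  then obtain i j where ij: "i < j" "j \<le> k" "\<bar>b i\<bar> = \<bar>b j\<bar>"
    by (metis linorder_neqE_nat)
  define m where "m = j - i"
  have m: "0 < m" "m \<le> k" using ij by (auto simp: m_def)
  obtain s :: int where s: "s = 1 \<or> s = -1" "b i = s * b j"
    using ij(3) by (metis abs_eq_iff mult_1 mult_minus_left)
  have "[3 ^ i * a = s * (3 ^ j * a)] (mod p)"
    using b(2)[of i] cong_scalar_left[OF b(2)[of j], of s] s(2) cong_sym cong_trans by metis
  moreover have "s * (3 ^ j * a) = 3 ^ i * a * (s * 3 ^ m)"
    using ij(1) by (simp add: m_def power_add[symmetric] mult_ac flip: power_add)
  ultimately have "p dvd 3 ^ i * a * (s * 3 ^ m) - 3 ^ i * a"
    by (metis cong_iff_dvd_diff cong_sym)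
  then have "p dvd 3 ^ i * (a * (s * 3 ^ m - 1))" by (simp add: algebra_simps)
  then have "p dvd s * 3 ^ m - 1" using n3 a prime_dvd_multD[OF p(1)] by blast
  moreover have "2 dvd s * 3 ^ m - 1" using s(1) by auto
  moreover have "coprime 2 p" using p by (intro primes_coprime) auto
  ultimately have "2 * p dvd s * 3 ^ m - 1" by (intro divides_mult)
  moreover have "(3::int) ^ m \<ge> 3" using m(1) self_le_power[of 3 m] by simp
  then have "s * 3 ^ m - 1 \<noteq> 0" "\<bar>s * 3 ^ m - 1\<bar> \<le> 3 ^ m + 1" using s(1) by auto
  ultimately have le: "2 * p \<le> 3 ^ m + 1" using zdvd_imp_le[of "2 * p" "\<bar>s * 3 ^ m - 1\<bar>"] by auto
  \<comment> \<open>The final estimate needs \<open>6 * 3 ^ m + 3\<close> to be at most the square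
    of \<open>3 ^ m\<close>, which fails for \<open>m = 1\<close>.\<close>
  have "m \<noteq> 1" using le p(2) by auto
  then have m9: "(3::int) ^ m \<ge> 9" using m(1) power_increasing[of 2 m "3::int"] by simp
  have "(2 * p)\<^sup>2 \<le> (3 ^ m + 1)\<^sup>2" using le p(2) by (intro power_mono) auto
  then have "4 * (3 * p\<^sup>2) \<le> 3 * (3 ^ m + 1)\<^sup>2" by (simp add: power_mult_distrib)
  also have "\<dots> = 3 * (3 ^ m)\<^sup>2 + 6 * 3 ^ m + 3" by (simp add: power2_eq_square algebra_simps)
  also have "\<dots> \<le> 4 * (3 ^ m)\<^sup>2"
  proof -
    have "9 * 3 ^ m \<le> ((3::int) ^ m)\<^sup>2"
      unfolding power2_eq_square using m9 by (intro mult_right_mono) auto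
    then show ?thesis using m9 by linarith
  qed
  also have "(3 ^ m)\<^sup>2 = (9::int) ^ m" by (simp add: power2_eq_square power_mult_distrib[symmetric])
  also have "4 * (9::int) ^ m \<le> 4 * 9 ^ k" using m by simp
  finally show ?thesis by (simp add: k_def)
qed

text \<open>With \<open>k\<close> pairs, \<open>card A - 1\<close> is \<open>2 * k\<close> if 0 is
  in \<open>A\<close> and \<open>2 * k - 1\<close> otherwise. In the latter case a factor 3 has to
  be gained; the determinant argument provides 4, the other two cases provide 3 directly. For
  \<open>p = 3\<close> three distinct elements suffice.\<close>

theorem midpoint_closed_symmetric_card:
  fixes p :: int
  assumes p: "prime p" "p \<noteq> 2" and fin: "finite A" and ne: "A \<noteq> {}"
    and sym: "\<And>a. a \<in> A \<Longrightarrow> - a \<in> A" and sep: "separated p A" and mp: "midpoint_closed p A"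
  shows "p\<^sup>2 \<le> 3 ^ (card A - 1)"
proof (cases "p = 3")
  case True
  obtain f g where fg: "\<And>a. a \<in> A \<Longrightarrow> f a \<in> A \<and> g a \<in> A \<and> f a \<noteq> a \<and> g a \<noteq> a \<and> f a \<noteq> g a
      \<and> [f a + g a = 2 * a] (mod p)"
    by (rule midpoints[OF p mp sep]) auto
  obtain a where a: "a \<in> A" using ne by blast
  have "card {a, f a, g a} \<le> card A" using fg[OF a] a fin by (intro card_mono) auto
  moreover have "card {a, f a, g a} = 3" using fg[OF a] by (auto simp: card_insert_if)
  ultimately have "(3::int) ^ 2 \<le> 3 ^ (card A - 1)" by (intro power_increasing) auto
  then show ?thesis using True by simp
next
  case False
  have p3: "p > 3" using p False prime_ge_2_int[of p] by linarith
  define k where "k = card {a \<in> A. 0 < a}"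
  have cA: "card A = 2 * k + (if 0 \<in> A then 1 else 0)"
    using card_symmetric[OF fin sym] by (simp add: k_def)
  have "3 * p\<^sup>2 \<le> 9 ^ k \<or> ((if 0 \<in> A then 1 else 2) * p)\<^sup>2 \<le> 9 ^ k"
  proof (cases "\<exists>S\<subseteq>A. S \<noteq> {} \<and> midpoint_closed p S \<and> (\<forall>a\<in>S. - a \<notin> S)")
    case True
    then obtain S where S: "S \<subseteq> A" "S \<noteq> {}" "midpoint_closed p S" "\<And>a. a \<in> S \<Longrightarrow> - a \<notin> S" by blast
    have finS: "finite S" using S(1) fin finite_subset by blast
    \<comment> \<open>\<open>S\<close> contains at most one element of each pair, hence at most
      \<open>k\<close> in all, and the exponent \<open>card S - 1\<close> leaves a factor 9 to
      spare.\<close>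
    have "inj_on abs S" using S(4) by (auto simp: inj_on_def abs_eq_iff)
    moreover have "abs ` S \<subseteq> {a \<in> A. 0 < a}"
    proof
      fix y assume "y \<in> abs ` S"
      then obtain x where x: "x \<in> S" "y = \<bar>x\<bar>" by blast
      then have "x \<noteq> 0" using S(4)[of x] by auto
      then show "y \<in> {a \<in> A. 0 < a}" using x S(1) sym by (auto simp: abs_if)
    qed
    ultimately have "card S \<le> k" unfolding k_def using fin by (intro card_inj_on_le) auto
    moreover have "card S \<noteq> 0" using S(2) finS by simp
    ultimately have c: "Suc (card S - 1) \<le> k" by simp
    have "p\<^sup>2 \<le> 6 ^ (card S - 1)"
      using midpoint_closed_card[OF p finS S(2,3)] separated_subset[OF sep S(1)] by blast
    also have "\<dots> \<le> 9 ^ (card S - 1)" by (intro power_mono) auto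
    finally have "p\<^sup>2 \<le> 9 ^ (card S - 1)" .
    then have "3 * p\<^sup>2 \<le> 9 * 9 ^ (card S - 1)"
      using zero_le_power[of "9 :: int" "card S - 1"] by linarith
    also have "\<dots> = 9 ^ Suc (card S - 1)" by simp
    also have "\<dots> \<le> 9 ^ k" using c by (intro power_increasing) auto
    finally show ?thesis ..
  next
    case nosym: False
    show ?thesis
    proof (cases "\<exists>a\<in>A. a \<noteq> 0 \<and> (\<forall>j. \<exists>b\<in>A. [b = 3 ^ j * a] (mod p))")
      case True
      then obtain a where a: "a \<in> A" "a \<noteq> 0" "\<And>j. \<exists>b\<in>A. [b = 3 ^ j * a] (mod p)" by blast
      have "\<not> p dvd a"
      proof
        assume "p dvd a"
        then have "[a = - a] (mod p)" by (simp add: cong_iff_dvd_diff)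
        then show False using separatedD[OF sep a(1) sym[OF a(1)]] a(2) by simp
      qed
      then show ?thesis using square_le_orbit[OF p(1) p3 fin sym _ a(3)] by (simp add: k_def)
    next
      case False
      interpret tripling_chains p A
        by unfold_locales (use p p3 fin sym sep False in auto)
      show ?thesis using square_le_chains[OF _ mp ne] nosym unfolding positives_def k_def by blast
    qed
  qed
  then have "(if 0 \<in> A then 1 else 3) * p\<^sup>2 \<le> 9 ^ k"
  proof
    assume "3 * p\<^sup>2 \<le> 9 ^ k"
    moreover have "(if 0 \<in> A then 1 else 3) * p\<^sup>2 \<le> 3 * p\<^sup>2" by (intro mult_right_mono) auto
    ultimately show ?thesis by linarith
  next
    assume "((if 0 \<in> A then 1 else 2) * p)\<^sup>2 \<le> 9 ^ k"
    moreover have "(if 0 \<in> A then 1 else 3) * p\<^sup>2 \<le> ((if 0 \<in> A then 1 else 2) * p)\<^sup>2"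
      by (simp add: power_mult_distrib)
    ultimately show ?thesis by linarith
  qed
  moreover have "(9::int) ^ k = 3 ^ (2 * k)" by (simp add: power_mult)
  moreover have "card A \<noteq> 0" using fin ne by simp
  then have "(3::int) ^ (2 * k) = (if 0 \<in> A then 1 else 3) * 3 ^ (card A - 1)"
    using cA by (auto simp: power_Suc[symmetric] simp del: power_Suc)
  ultimately show ?thesis by (auto split: if_splits)
qed

subsection \<open>Translation to the residue ring\<close>

context
  fixes p :: nat
  assumes p: "prime p" "p \<noteq> 2"
begin

lemma residue_minus:
  assumes "a \<in> carrier (residue_ring (int p))" "b \<in> carrier (residue_ring (int p))"
  shows "a \<ominus>\<^bsub>residue_ring (int p)\<^esub> b = (a - b) mod int p"
proof -
  define R where "R = residue_ring (int p)"
  interpret residues_prime p R using p by unfold_locales (auto simp: R_def)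
  have "a \<ominus>\<^bsub>R\<^esub> b = (a - b) mod int p"
    by (simp add: a_minus_def res_neg_eq res_add_eq mod_simps)
  then show ?thesis by (simp add: R_def)
qed

lemma residue_uminus: "\<ominus>\<^bsub>residue_ring (int p)\<^esub> a = (- a) mod int p"
proof -
  define R where "R = residue_ring (int p)"
  interpret residues_prime p R using p by unfold_locales (auto simp: R_def)
  show ?thesis using res_neg_eq by (simp add: R_def)
qed

lemma residue_carrier: "carrier (residue_ring (int p)) = {0..<int p}"
  by (auto simp: residue_ring_def)

lemma symmetric_subset_iff:
  "symmetric_subset (residue_ring (int p)) B \<longleftrightarrow>
     B \<subseteq> {0..<int p} \<and> (\<forall>b\<in>B. (- b) mod int p \<in> B)"
proof -
  have *: "(- ((- b) mod int p)) mod int p = b" if "b \<in> {0..<int p}" for b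
    using that by (simp add: mod_minus_eq)
  show ?thesis unfolding symmetric_subset_def residue_uminus residue_carrier
  proof (intro conj_cong refl iffI ballI)
    assume "B = (\<lambda>b. (- b) mod int p) ` B"
    then show "(- b) mod int p \<in> B" if "b \<in> B" for b using that by blast
  next
    assume B: "B \<subseteq> {0..<int p}" and s: "\<forall>b\<in>B. (- b) mod int p \<in> B"
    show "B = (\<lambda>b. (- b) mod int p) ` B"
    proof
      show "B \<subseteq> (\<lambda>b. (- b) mod int p) ` B"
      proof
        fix b assume b: "b \<in> B"
        then have "b = (- ((- b) mod int p)) mod int p" using * B by auto
        then show "b \<in> (\<lambda>b. (- b) mod int p) ` B" using s b by blast
      qed
    qed (use s in auto)
  qed
qed

lemma cong_carrier:
  "a \<in> {0..<int p} \<Longrightarrow> b \<in> {0..<int p} \<Longrightarrow> [a = b] (mod int p) \<Longrightarrow> a = b"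
  by (simp add: cong_def)

text \<open>If \<open>x = a - b\<close> is a unique difference, the pairs \<open>(a, b)\<close> and
  \<open>(-b, -a)\<close> coincide, so \<open>b = -a\<close> and \<open>x = 2a\<close>. A second
  representation \<open>2a = c - d\<close> is a midpoint equation for \<open>c\<close> and
  \<open>-d\<close>.\<close>

lemma not_unique_difference_iff:
  assumes B: "symmetric_subset (residue_ring (int p)) B"
  shows "\<not> has_unique_difference (residue_ring (int p)) B \<longleftrightarrow> midpoint_closed (int p) B"
proof -
  let ?R = "residue_ring (int p)"
  have sub: "B \<subseteq> {0..<int p}" and neg: "\<And>b. b \<in> B \<Longrightarrow> (- b) mod int p \<in> B"
    using B by (auto simp: symmetric_subset_iff)
  have pos: "0 < int p" using p by (simp add: prime_gt_0_nat)
  have diff: "a \<ominus>\<^bsub>?R\<^esub> b = (a - b) mod int p" if "a \<in> B" "b \<in> B" for a b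
    using that sub by (intro residue_minus) (auto simp: residue_carrier)
  have eqI: "a = b" if "a \<in> B" "b \<in> B" "[a = b] (mod int p)" for a b
    using that sub by (auto intro: cong_carrier)
  have negc: "[(- b) mod int p = - b] (mod int p)" for b by simp
  show ?thesis
  proof
    assume nu: "\<not> has_unique_difference ?R B"
    show "midpoint_closed (int p) B" unfolding midpoint_closed_def
    proof
      fix a assume a: "a \<in> B"
      let ?a' = "(- a) mod int p"
      let ?x = "a \<ominus>\<^bsub>?R\<^esub> ?a'"
      have x: "?x = (2 * a) mod int p" using diff[OF a neg[OF a]] by (simp add: mod_simps)
      have "?x \<in> carrier ?R" using pos by (simp add: x residue_carrier)
      then obtain cd where cd: "cd \<in> B \<times> B" "?x = fst cd \<ominus>\<^bsub>?R\<^esub> snd cd" "cd \<noteq> (a, ?a')"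
        using nu a neg[OF a] unfolding has_unique_difference_def by (metis SigmaI fst_conv snd_conv)
      obtain c d where c: "c \<in> B" "d \<in> B" "cd = (c, d)" using cd(1) by auto
      have e: "[c - d = 2 * a] (mod int p)"
        using cd(2) c x diff[OF c(1,2)] by (simp add: cong_def)
      have "\<not> [c = a] (mod int p)"
      proof
        assume "[c = a] (mod int p)"
        then have ca: "c = a" using eqI c a by blast
        then have "[d = - a] (mod int p)" using e by (simp add: cong_iff_dvd_diff dvd_diff_commute algebra_simps)
        then have "d = ?a'" using eqI[OF c(2) neg[OF a]] negc cong_trans cong_sym by blast
        then show False using cd(3) c(3) ca by simp
      qed
      moreover have "[c + (- d) mod int p = c - d] (mod int p)" by (simp add: cong_def mod_simps)
      then have "[c + (- d) mod int p = 2 * a] (mod int p)" using e cong_trans by blast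
      ultimately show "\<exists>b\<in>B. \<exists>c\<in>B. \<not> [b = a] (mod int p) \<and> [b + c = 2 * a] (mod int p)"
        using c neg by blast
    qed
  next
    assume mp: "midpoint_closed (int p) B"
    show "\<not> has_unique_difference ?R B"
    proof
      assume "has_unique_difference ?R B"
      then obtain x ab where ab: "ab \<in> B \<times> B" "x = fst ab \<ominus>\<^bsub>?R\<^esub> snd ab"
        and u: "\<And>z. z \<in> B \<times> B \<and> x = fst z \<ominus>\<^bsub>?R\<^esub> snd z \<Longrightarrow> z = ab"
        unfolding has_unique_difference_def by (elim bexE ex1E conjE) blast
      obtain a b where [simp]: "ab = (a, b)" by (cases ab)
      have a: "a \<in> B" "b \<in> B" and x: "x = (a - b) mod int p" using ab diff by auto
      have u': "c = a" if "c \<in> B" "d \<in> B" "[c - d = a - b] (mod int p)" for c d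
        using u[of "(c, d)"] that x diff[of c d] by (simp add: cong_def)
      have "(- b) mod int p = a"
        using u'[OF neg[OF a(2)] neg[OF a(1)]] by (simp add: cong_def mod_simps)
      then have ba: "[a = - b] (mod int p)" using negc by metis
      obtain c d where c: "c \<in> B" "d \<in> B" "\<not> [c = a] (mod int p)" "[c + d = 2 * a] (mod int p)"
        using mp a(1) unfolding midpoint_closed_def by blast
      have "[c - (- d) mod int p = c + d] (mod int p)" by (simp add: cong_def mod_simps)
      also note c(4)
      also have "[2 * a = a - b] (mod int p)"
        using cong_add[OF cong_refl[of a] ba] by simp
      finally have "c = a" using u' c neg by blast
      then show False using c(3) by simp
    qed
  qed
qed

text \<open>The property depends only on residues, so representatives may be changed; used for
  reduction modulo \<open>p\<close> and for passing to signed representatives.\<close>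

lemma midpoint_closed_image:
  assumes C: "midpoint_closed (int p) C" and h: "\<And>x. x \<in> C \<Longrightarrow> [h x = x] (mod int p)"
  shows "midpoint_closed (int p) (h ` C)"
  unfolding midpoint_closed_def
proof
  fix a assume "a \<in> h ` C"
  then obtain x where x: "x \<in> C" "a = h x" by blast
  obtain y z where yz: "y \<in> C" "z \<in> C" "\<not> [y = x] (mod int p)" "[y + z = 2 * x] (mod int p)"
    using C x(1) unfolding midpoint_closed_def by blast
  have "\<not> [h y = h x] (mod int p)" using h x yz by (meson cong_sym cong_trans)
  moreover have "[h y + h z = 2 * h x] (mod int p)"
    using cong_trans[OF cong_add[OF h[OF yz(1)] h[OF yz(2)]] yz(4)]
      cong_scalar_left[OF h[OF x(1)], of 2] cong_sym cong_trans by blast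
  ultimately show "\<exists>b\<in>h ` C. \<exists>c\<in>h ` C. \<not> [b = a] (mod int p) \<and> [b + c = 2 * a] (mod int p)"
    using yz(1,2) x(2) by blast
qed

text \<open>Reduction modulo \<open>p\<close> may merge elements of \<open>C\<close>, which only
  lowers the cardinality of the resulting counterexample.\<close>

lemma g_less_card:
  assumes fin: "finite C" and ne: "C \<noteq> {}" and sym: "\<And>x. x \<in> C \<Longrightarrow> - x \<in> C"
    and C: "midpoint_closed (int p) C"
  shows "g p < card C"
proof (rule ccontr)
  assume "\<not> g p < card C"
  let ?B = "(\<lambda>x. x mod int p) ` C"
  have "card ?B \<le> g p" using card_image_le[OF fin, of "\<lambda>x. x mod int p"] \<open>\<not> g p < card C\<close> by linarith
  moreover have "symmetric_subset (residue_ring (int p)) ?B"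
    unfolding symmetric_subset_iff using sym p
    by (auto simp: prime_gt_0_nat mod_simps intro!: imageI)
  moreover have "midpoint_closed (int p) ?B" using C by (rule midpoint_closed_image) simp
  ultimately show False
    using le_g_iff[OF p(1), of "g p"] not_unique_difference_iff[of ?B] ne by blast
qed

text \<open>Maximality of \<open>g p\<close> yields a counterexample with at most one more element.
  On representatives of absolute value below \<open>p / 2\<close>, negation modulo \<open>p\<close>
  is negation of integers.\<close>

lemma g_attained:
  obtains A where "finite A" "A \<noteq> {}" "\<And>a. a \<in> A \<Longrightarrow> - a \<in> A" "separated (int p) A"
    "midpoint_closed (int p) A" "card A \<le> Suc (g p)"
proof -
  have "\<not> Suc (g p) \<le> g p" by simp
  then obtain B where B: "symmetric_subset (residue_ring (int p)) B" "B \<noteq> {}" "card B \<le> Suc (g p)"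
    "\<not> has_unique_difference (residue_ring (int p)) B"
    unfolding le_g_iff[OF p(1)] by blast
  have sub: "B \<subseteq> {0..<int p}" and neg: "\<And>b. b \<in> B \<Longrightarrow> (- b) mod int p \<in> B"
    using B(1) by (auto simp: symmetric_subset_iff)
  have mpB: "midpoint_closed (int p) B" using B not_unique_difference_iff by blast
  define h where "h x = (if 2 * x < int p then x else x - int p)" for x
  have h: "[h x = x] (mod int p)" for x by (simp add: h_def cong_iff_dvd_diff)
  have finB: "finite B" using sub finite_subset by blast
  have op: "odd (int p)" using p prime_odd_nat prime_ge_2_nat[of p] by auto
  have "- a \<in> h ` B" if a: "a \<in> h ` B" for a
  proof -
    obtain x where x: "x \<in> B" "a = h x" using a by blast
    have x': "0 \<le> x" "x < int p" using sub x by auto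
    \<comment> \<open>No residue sits on the boundary \<open>p / 2\<close>, so \<open>h\<close>
      commutes with negation.\<close>
    have "2 * x \<noteq> int p" using op by (metis dvd_triv_left)
    then have "h ((- x) mod int p) = - h x"
      using x' by (auto simp: h_def zmod_zminus1_eq_if)
    then show ?thesis using neg[OF x(1)] x(2) by (metis imageI)
  qed
  moreover have "separated (int p) (h ` B)" unfolding separated_def
  proof (intro ballI impI)
    fix x y assume xy: "x \<in> h ` B" "y \<in> h ` B" "[x = y] (mod int p)"
    then obtain a b where ab: "a \<in> B" "b \<in> B" "x = h a" "y = h b" by blast
    then have "[a = b] (mod int p)" using h xy(3) by (meson cong_sym cong_trans)
    then show "x = y" using cong_carrier sub ab by blast
  qed
  moreover have "midpoint_closed (int p) (h ` B)" using mpB h by (rule midpoint_closed_image)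
  moreover have "card (h ` B) \<le> Suc (g p)" using card_image_le[OF finB, of h] B(3) by linarith
  ultimately show ?thesis using that[of "h ` B"] finB B(2) by auto
qed

end

subsection \<open>The upper bound\<close>

text \<open>In base \<open>2 * 3 ^ s\<close> the quotients are the prefixes of \<open>N\<close>, and
  \<open>i\<close> counts the multiplications by 3 on the way to the next prefix. The last prefix
  \<open>N\<close> is left out, as 0 represents it modulo a divisor of \<open>N\<close>.\<close>

definition digit_chain :: "nat \<Rightarrow> nat \<Rightarrow> int \<Rightarrow> int set" where
  "digit_chain s J N = (\<lambda>(j, i). 3 ^ i * (N div (2 * 3 ^ s) ^ (J - j))) ` ({..<J} \<times> {..s})"

definition digit_set :: "nat \<Rightarrow> nat \<Rightarrow> int \<Rightarrow> int set" where
  "digit_set s J N = {1 - 2 * 3 ^ s..2 * 3 ^ s - 1} \<union> digit_chain s J N \<union> uminus ` digit_chain s J N"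

lemma digit_set_uminus: "x \<in> digit_set s J N \<Longrightarrow> - x \<in> digit_set s J N"
  by (auto simp: digit_set_def)

lemma finite_digit_set: "finite (digit_set s J N)"
  by (simp add: digit_set_def digit_chain_def)

lemma card_digit_set: "card (digit_set s J N) \<le> 4 * 3 ^ s + 2 * (J * (s + 1))"
proof -
  have c: "card (digit_chain s J N) \<le> J * (s + 1)"
    unfolding digit_chain_def by (rule order.trans[OF card_image_le]) auto
  have "card (uminus ` digit_chain s J N) \<le> J * (s + 1)"
    by (rule order.trans[OF card_image_le c]) (simp add: digit_chain_def)
  moreover have "card {1 - 2 * 3 ^ s..2 * 3 ^ s - 1 :: int} \<le> 4 * 3 ^ s"
    by (simp add: nat_le_iff)
  moreover have "card (digit_set s J N) \<le> card {1 - 2 * 3 ^ s..2 * 3 ^ s - 1 :: int}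
     + card (digit_chain s J N) + card (uminus ` digit_chain s J N)"
    unfolding digit_set_def by (meson add_le_mono1 card_Un_le order_trans)
  ultimately show ?thesis using c by linarith
qed

text \<open>Small integers are midpoints of their two neighbours, and chain elements with
  \<open>i < s\<close> have their triple in the set. For \<open>i = s\<close>, twice the element is
  the next prefix minus its last digit, and the negative of that digit is a small integer.\<close>

lemma midpoint_closed_digit_set:
  fixes p N :: int
  assumes p: "prime p" "p \<noteq> 2" and big: "2 * 3 ^ s \<le> p" and s: "0 < s" and J: "0 < J"
    and N: "p dvd N" "N div (2 * 3 ^ s) ^ J = 2 * 3 ^ s - 1"
  shows "midpoint_closed p (digit_set s J N)"
proof -
  let ?C = "digit_set s J N"
  define q :: int where "q = 2 * 3 ^ s"
  define h where "h j = N div q ^ (J - j)" for j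
  define D where "D a \<longleftrightarrow> (\<exists>b\<in>?C. \<exists>c\<in>?C. \<not> [b = a] (mod p) \<and> [b + c = 2 * a] (mod p))" for a
  have q2: "q \<ge> 6" using s self_le_power[of "3::int" s] by (simp add: q_def)
  have p2: "p > 2" using p prime_ge_2_int[of p] by linarith
  have np2: "\<not> p dvd 2" using p2 zdvd_imp_le[of p 2] by auto
  have np1: "\<not> p dvd 1" using p2 by (simp add: zdvd1_eq)
  have table: "a \<in> ?C" if "\<bar>a\<bar> < q" for a using that by (auto simp: digit_set_def q_def)
  have chain: "3 ^ i * h j \<in> ?C" if "j < J" "i \<le> s" for i j
    using that unfolding digit_set_def digit_chain_def h_def q_def by force
  have D_uminus: "D (- a)" if "D a" for a
  proof -
    obtain b c where bc: "b \<in> ?C" "c \<in> ?C" "\<not> [b = a] (mod p)" "[b + c = 2 * a] (mod p)"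
      using \<open>D a\<close> unfolding D_def by blast
    have "\<not> [- b = - a] (mod p)" using bc(3) by (simp add: cong_minus_minus_iff)
    moreover have "[- (b + c) = - (2 * a)] (mod p)" using bc(4) by (simp only: cong_minus_minus_iff)
    ultimately show ?thesis unfolding D_def
      using bc(1,2) by (intro bexI[of _ "- b"] bexI[of _ "- c"]) (auto intro: digit_set_uminus)
  qed
  have D_cong: "D a" if "D a'" "[a = a'] (mod p)" for a a'
  proof -
    obtain b c where bc: "b \<in> ?C" "c \<in> ?C" "\<not> [b = a'] (mod p)" "[b + c = 2 * a'] (mod p)"
      using \<open>D a'\<close> unfolding D_def by blast
    have "\<not> [b = a] (mod p)" using bc(3) that(2) cong_trans by blast
    moreover have "[b + c = 2 * a] (mod p)"
      using bc(4) cong_scalar_left[OF that(2), of 2] cong_sym cong_trans by blast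
    ultimately show ?thesis unfolding D_def using bc(1,2) by blast
  qed
  have D_triple: "D a" if "a \<in> ?C" "3 * a \<in> ?C" for a
  proof (cases "p dvd a")
    case True
    \<comment> \<open>Tripling a multiple of \<open>p\<close> gives back the same residue, so 1 and
      -1 are used instead.\<close>
    have "\<not> [1 = a] (mod p)" using True np1 cong_dvd_iff by blast
    moreover have "[1 + (- 1) = 2 * a] (mod p)" using True by (simp add: cong_iff_dvd_diff)
    ultimately show ?thesis unfolding D_def
      using table q2 by (intro bexI[of _ 1] bexI[of _ "-1"]) auto
  next
    case False
    have "\<not> [3 * a = a] (mod p)"
    proof
      assume "[3 * a = a] (mod p)"
      then have "p dvd 2 * a" by (simp add: cong_iff_dvd_diff)
      then show False using False np2 prime_dvd_multD[OF p(1)] by blast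
    qed
    then show ?thesis unfolding D_def
      using that by (intro bexI[of _ "3 * a"] bexI[of _ "- a"]) (auto intro: digit_set_uminus)
  qed
  have h0: "h 0 = q - 1" using N(2) by (simp add: h_def q_def)
  have D_table: "D a" if a: "\<bar>a\<bar> < q" for a
  proof (cases "\<bar>a\<bar> = q - 1")
    case True
    \<comment> \<open>The neighbour \<open>q\<close> lies outside the table, but
      \<open>q - 1\<close> is the leading prefix and \<open>s > 0\<close> puts its triple on the
      chain.\<close>
    have "q - 1 \<in> ?C" "3 * (q - 1) \<in> ?C"
      using chain[OF J, of 0] chain[OF J, of 1] s h0 by auto
    then have "D (q - 1)" by (rule D_triple)
    then have "D \<bar>a\<bar>" using True by simp
    then show ?thesis using D_uminus[of "\<bar>a\<bar>"] by (cases "a \<ge> 0") auto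
  next
    case False
    have "\<not> [a + 1 = a] (mod p)" using np1 by (simp add: cong_iff_dvd_diff)
    then show ?thesis unfolding D_def
      using False a by (intro bexI[of _ "a + 1"] bexI[of _ "a - 1"] table) auto
  qed
  have D_chain: "D (3 ^ i * h j)" if j: "j < J" and i: "i \<le> s" for i j
  proof (cases "i < s")
    case True
    then show ?thesis using chain[OF j, of i] chain[OF j, of "Suc i"]
      by (intro D_triple) (auto simp: mult.assoc)
  next
    case False
    then have i: "i = s" using i by simp
    let ?a = "3 ^ s * h j"
    define d where "d = h (Suc j) mod q"
    have d: "0 \<le> d" "d < q" using q2 by (auto simp: d_def)
    have "q ^ (J - j) = q ^ (J - Suc j) * q"
      using j by (metis Suc_diff_Suc power_Suc2)
    then have "h j = h (Suc j) div q"
      unfolding h_def using q2 by (simp add: zdiv_zmult2_eq)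
    then have step: "2 * ?a = h (Suc j) - d" by (simp add: d_def q_def minus_mod_eq_mult_div)
    obtain b where b: "b \<in> ?C" "[b = h (Suc j)] (mod p)"
    proof (cases "Suc j < J")
      case True
      then show ?thesis using that[of "h (Suc j)"] chain[of "Suc j" 0] by simp
    next
      case False
      then have "h (Suc j) = N" using j by (simp add: h_def)
      then show ?thesis using that[of 0] N(1) table[of 0] q2 by (simp add: cong_iff_dvd_diff)
    qed
    have bd: "[b + (- d) = 2 * ?a] (mod p)" using cong_diff[OF b(2) cong_refl[of d]] step by simp
    show ?thesis unfolding i
    \<comment> \<open>If the next prefix coincides with \<open>?a\<close> modulo \<open>p\<close>,
      then \<open>?a\<close> is congruent to \<open>- d\<close>, whose midpoints are already
      known.\<close>
    proof (cases "[b = ?a] (mod p)")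
      case True
      then have "[?a = - d] (mod p)"
      proof -
        have "b + (- d) - b = - d" "2 * ?a - ?a = ?a" by simp_all
        then show ?thesis using cong_diff[OF bd True] cong_sym by metis
      qed
      moreover have "D (- d)" using D_table[of "- d"] d by simp
      ultimately show "D ?a" by (rule D_cong[rotated])
    next
      case False
      moreover have "- d \<in> ?C" using table[of "- d"] d by simp
      ultimately show "D ?a" unfolding D_def using b(1) bd by blast
    qed
  qed
  have "D a" if a: "a \<in> ?C" for a
  proof -
    consider "\<bar>a\<bar> < q" | "a \<in> digit_chain s J N" | "- a \<in> digit_chain s J N"
      using a by (force simp: digit_set_def q_def)
    moreover have "D a" if "a \<in> digit_chain s J N" for a
      using that D_chain by (auto simp: digit_chain_def h_def q_def)
    ultimately show ?thesis using D_table D_uminus[of "- a"] by cases auto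
  qed
  then show ?thesis unfolding midpoint_closed_def D_def by blast
qed

lemma g_le_digits:
  assumes p: "prime p" "p \<noteq> 2" and s: "0 < s" and J: "0 < J"
    and big: "2 * 3 ^ s \<le> p" "p \<le> (2 * 3 ^ s) ^ J"
  shows "g p \<le> 4 * 3 ^ s + 2 * (J * (s + 1))"
proof -
  define q :: int where "q = 2 * 3 ^ s"
  \<comment> \<open>The largest multiple of \<open>p\<close> below \<open>q ^ Suc J\<close>; since
    \<open>p\<close> is at most \<open>q ^ J\<close>, its leading digit is
    \<open>q - 1\<close>.\<close>
  define N where "N = int p * ((q ^ Suc J - 1) div int p)"
  have q: "q > 0" by (simp add: q_def)
  have pq: "int p \<le> q ^ J" using big(2) by (simp add: q_def flip: of_nat_le_iff[where 'a=int])
  have p0: "int p > 0" using p(1) by (simp add: prime_gt_0_nat)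
  have "N + (q ^ Suc J - 1) mod int p = q ^ Suc J - 1" unfolding N_def by (rule mult_div_mod_eq)
  then have "N \<le> q ^ Suc J - 1" "q ^ Suc J - 1 < N + int p"
    using pos_mod_bound[OF p0, of "q ^ Suc J - 1"] pos_mod_sign[OF p0, of "q ^ Suc J - 1"]
    by linarith+
  then have "(q - 1) * q ^ J \<le> N" "N < q * q ^ J" using pq by (auto simp: left_diff_distrib)
  then have "N div q ^ J = q - 1"
    using q by (intro int_div_pos_eq[of _ _ _ "N - (q - 1) * q ^ J"]) (auto simp: algebra_simps)
  then have "midpoint_closed (int p) (digit_set s J N)"
    using p s J big(1) by (intro midpoint_closed_digit_set) (auto simp: N_def q_def simp flip: of_nat_le_iff[where 'a=int])
  moreover have "0 \<in> digit_set s J N"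
  proof -
    have "(0::int) < 3 ^ s" by simp
    then have "1 \<le> 2 * (3::int) ^ s" by linarith
    then show ?thesis by (simp add: digit_set_def)
  qed
  ultimately have "g p < card (digit_set s J N)"
    using g_less_card[OF p finite_digit_set[of s J N]] digit_set_uminus by blast
  then show ?thesis using card_digit_set[of s J N] by linarith
qed

text \<open>Take \<open>J\<close> as \<open>log q p\<close> rounded up. As \<open>log 3 q\<close> is
  at least \<open>s\<close>, the chains cost \<open>2 * (1 + 1 / s) * log 3 p\<close>; the rounding
  and the small integers make up the constant.\<close>

lemma g_le_log:
  assumes p: "prime p" "p \<noteq> 2" and s: "0 < s" and big: "2 * 3 ^ s \<le> p"
  shows "real (g p) \<le> 2 * (1 + 1 / real s) * log 3 (real p) + real (4 * 3 ^ s + 2 * (s + 1))"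
proof -
  define q :: real where "q = 2 * 3 ^ s"
  define J where "J = nat \<lceil>log q (real p)\<rceil>"
  have p1: "real p > 1" using p(1) prime_gt_1_nat by simp
  have q3: "q \<ge> 3 ^ s" "q > 1" by (auto simp: q_def intro: less_le_trans[of 1 2])
  have lp: "log 3 (real p) > 0" using p1 by simp
  have lq: "log q (real p) > 0" using p1 q3 by simp
  have Jr: "log q (real p) \<le> real J" "real J \<le> log q (real p) + 1" using lq by (auto simp: J_def)
  have "real p \<le> q powr real J" using Jr(1) p1 q3 by (simp add: log_le_iff)
  then have "real p \<le> real ((2 * 3 ^ s) ^ J)" using q3 by (simp add: powr_realpow q_def)
  then have "p \<le> (2 * 3 ^ s) ^ J" by (simp only: of_nat_le_iff)
  moreover have "J > 0" using lq by (simp add: J_def)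
  ultimately have g: "g p \<le> 4 * 3 ^ s + 2 * (J * (s + 1))" using g_le_digits p s big by blast
  have "real s = log 3 (3 ^ s)" by simp
  also have "\<dots> \<le> log 3 q" by (subst log_le_cancel_iff) (use q3 in auto)
  finally have ls: "real s \<le> log 3 q" .
  have "log q (real p) = log 3 (real p) / log 3 q" using q3 p1 by (intro log_base_change) auto
  also have "\<dots> \<le> log 3 (real p) / real s" using ls s lp by (intro divide_left_mono) auto
  finally have "real J \<le> log 3 (real p) / real s + 1" using Jr(2) by linarith
  then have "real J * (real s + 1) \<le> (log 3 (real p) / real s + 1) * (real s + 1)"
    by (intro mult_right_mono) auto
  also have "\<dots> = (1 + 1 / real s) * log 3 (real p) + (real s + 1)" using s by (simp add: field_simps)
  finally have "2 * (real J * (real s + 1)) \<le> 2 * ((1 + 1 / real s) * log 3 (real p) + (real s + 1))"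
    by (rule mult_left_mono) simp
  also have "\<dots> = 2 * (1 + 1 / real s) * log 3 (real p) + 2 * (real s + 1)"
    by (subst distrib_left) (simp only: mult.assoc)
  finally have "2 * (real J * (real s + 1))
    \<le> 2 * (1 + 1 / real s) * log 3 (real p) + 2 * (real s + 1)" .
  moreover have "real (g p) \<le> real (4 * 3 ^ s + 2 * (J * (s + 1)))" using g by (simp only: of_nat_le_iff)
  moreover have "real (4 * 3 ^ s + 2 * (J * (s + 1))) = real (4 * 3 ^ s) + 2 * (real J * (real s + 1))"
    "real (4 * 3 ^ s + 2 * (s + 1)) = real (4 * 3 ^ s) + 2 * (real s + 1)"
    by (simp_all add: algebra_simps)
  ultimately show ?thesis by linarith
qed

lemma g_upper:
  assumes "\<epsilon> > 0"
  shows "\<exists>C::real. \<forall>p. prime p \<and> real p > C \<longrightarrow> real (g p) \<le> (2 + \<epsilon>) * log 3 (real p)"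
proof -
  \<comment> \<open>Half of \<open>\<epsilon>\<close> covers \<open>2 / s\<close>, whence
    \<open>4 / \<epsilon>\<close>; the other half absorbs the constant \<open>c\<close> once
    \<open>log 3 p\<close> exceeds \<open>2 * c / \<epsilon>\<close>.\<close>
  obtain s :: nat where s: "real s > 4 / \<epsilon>" using reals_Archimedean2 by blast
  have s0: "0 < s" using s assms by (metis divide_pos_pos gr0I less_trans of_nat_0 less_irrefl zero_less_numeral)
  define c where "c = real (4 * 3 ^ s + 2 * (s + 1))"
  have es: "2 / real s \<le> \<epsilon> / 2" using s s0 assms by (simp add: field_simps)
  show ?thesis
  proof (intro exI[of _ "max (real (2 * 3 ^ s)) (3 powr (2 * c / \<epsilon>))"] allI impI, elim conjE)
    fix p :: nat
    assume p: "prime p" and "real p > max (real (2 * 3 ^ s)) (3 powr (2 * c / \<epsilon>))"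
    then have big: "2 * 3 ^ s < p" and pc: "3 powr (2 * c / \<epsilon>) < real p"
      by (simp_all only: max_less_iff_conj of_nat_less_iff)
    have "(2::nat) \<le> 2 * 3 ^ s" by simp
    then have p2: "p \<noteq> 2" using big by linarith
    have p0: "real p > 0" using p by (simp add: prime_gt_0_nat)
    have "2 * c / \<epsilon> < log 3 (real p)" using pc p0 by (simp add: less_log_iff)
    then have "c \<le> \<epsilon> / 2 * log 3 (real p)" using assms by (simp add: field_simps)
    moreover have "2 / real s * log 3 (real p) \<le> \<epsilon> / 2 * log 3 (real p)"
      using es prime_ge_1_nat[OF p] by (intro mult_right_mono) auto
    moreover have "real (g p) \<le> 2 * (1 + 1 / real s) * log 3 (real p) + c"
      unfolding c_def using g_le_log[OF p p2 s0] big by simp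
    moreover have "2 * (1 + 1 / real s) * log 3 (real p) = 2 * log 3 (real p) + 2 / real s * log 3 (real p)"
      by (simp add: algebra_simps)
    ultimately show "real (g p) \<le> (2 + \<epsilon>) * log 3 (real p)" by (simp add: algebra_simps)
  qed
qed

text \<open>The lower bound excludes the prime 2, where it fails by
  \<open>lower_bound_fails_at_2\<close>. For odd primes the set from \<open>g_attained\<close> has
  at most \<open>g p + 1\<close> elements, which matches the exponent
  \<open>card A - 1\<close>.\<close>

theorem corollary1p3:
  shows "(\<forall>p. prime p \<and> p \<noteq> 2 \<longrightarrow> real (g p) \<ge> 2 * log 3 (real p)) \<and>
    (\<forall>\<epsilon>::real. \<epsilon> > 0 \<longrightarrow> (\<exists>C::real. \<forall>p. prime p \<and> real p > C \<longrightarrow>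
       real (g p) \<le> (2 + \<epsilon>) * log 3 (real p)))"
proof (intro conjI allI impI)
  fix p :: nat
  assume p: "prime p \<and> p \<noteq> 2"
  then obtain A where A: "finite A" "A \<noteq> {}" "\<And>a. a \<in> A \<Longrightarrow> - a \<in> A" "separated (int p) A"
    "midpoint_closed (int p) A" "card A \<le> Suc (g p)"
    using g_attained by blast
  have "(int p)\<^sup>2 \<le> 3 ^ (card A - 1)"
    using p A by (intro midpoint_closed_symmetric_card) auto
  also have "\<dots> \<le> 3 ^ g p" using A(6) by (intro power_increasing) auto
  finally have "int (p\<^sup>2) \<le> int (3 ^ g p)" by simp
  then have le: "real (p\<^sup>2) \<le> real (3 ^ g p)" by (simp only: of_nat_le_iff)
  have p0: "real p > 0" using p by (simp add: prime_gt_0_nat)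
  have "2 * log 3 (real p) = log 3 ((real p)\<^sup>2)" using p0 by (simp add: log_nat_power)
  also have "\<dots> \<le> log 3 (3 ^ g p)" by (subst log_le_cancel_iff) (use le p0 in auto)
  also have "\<dots> = real (g p)" by simp
  finally show "2 * log 3 (real p) \<le> real (g p)" .
qed (rule g_upper)

end
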